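(* For any freshness environment $\nabla$, equational nominal unification problem $P$, and nominal substitution $\sigma$ with $\mathrm{Vars}(P)\subseteq\mathrm{Dom}(\sigma)$: the pair $\langle\nabla,\sigma\rangle$ solves $P$ if and only if the $\lambda$-substitution $[\sigma]_\nabla$ solves the pattern unification problem $[P]$.
   Context: Nominal setting. Atoms (each of a sort of atoms), variables $X$ with sorts, function symbols $f$; nominal terms $t::=f(t_1,\dots,t_n)\mid a\mid a.t\mid\pi\cdot X$, where a permutation $\pi$ is a finite sequence of swappings $(a\,b)$ of same-sort atoms, acting on atoms by $(a\,b)\cdot a=b$, $(a\,b)\cdot b=a$, $(a\,b)\cdot c=c$ otherwise, and on terms homomorphically with $(a\,b)\cdot(c.t)=((a\,b)\cdot c).((a\,b)\cdot t)$, $(a\,b)\cdot(\pi\cdot X)=((a\,b)\pi)\cdot X$. A nominal substitution $\sigma=[X_1\mapsto t_1,\dots]$, $\mathrm{Dom}(\sigma)=\{X_1,\dots\}$, replaces variables without renaming, with $\sigma(\pi\cdot X)=\pi\cdot\sigma(X)$. A freshness environment $\nabla$ is a finite set of constraints $a\#X$; judgments $\nabla\vdash a\#t$, $\nabla\vdash t\approx u$ are the least relations closed under: $\nabla\vdash a\#a'$ if $a\ne a'$; $\nabla\vdash a\#\pi\cdot X$ if $(\pi^{-1}\cdot a)\#X\in\nabla$; $\nabla\vdash a\#f(\vec t)$ if $\nabla\vdash a\#t_i$ for all $i$; $\nabla\vdash a\#a.t$; $\nabla\vdash a\#a'.t$ if $a\ne a'$ and $\nabla\vdash a\#t$; $\nabla\vdash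 a\approx a$; $\nabla\vdash\pi\cdot X\approx\pi'\cdot X$ if $a\#X\in\nabla$ for all $a$ with $\pi\cdot a\ne\pi'\cdot a$; $\nabla\vdash f(\vec t)\approx f(\vec t')$ if $\nabla\vdash t_i\approx t_i'$ for all $i$; $\nabla\vdash a.t\approx a.t'$ if $\nabla\vdash t\approx t'$; $\nabla\vdash a.t\approx a'.t'$ if $a\ne a'$, $\nabla\vdash t\approx(a\,a')\cdot t'$ and $\nabla\vdash a\#t'$. An equational nominal unification problem $P$ is a finite set of equations $t\stackrel{?}{\approx}u$; $\mathrm{Vars}(P)$ is the set of variables occurring in it; $\langle\nabla,\sigma\rangle$ solves $P$ if $\nabla\vdash\sigma(t)\approx\sigma(u)$ for every equation. Translation (standing assumption: $\langle a_1,\dots,a_n\rangle$ is a fixed ordered list of pairwise distinct atoms, the atoms used in the problem, containing all atoms under consideration). Base types named by sorts; $[\nu]=\nu$, $[\delta]=\delta$, $[\langle\nu\rangle\tau]=\nu\to[\tau]$, $[\tau_1\times\cdots\times\tau_n\to\tau]=[\tau_1]\to\cdots\to[\tau_n]\to[\tau]$; atoms become $\lambda$-variables of the same name, function symbols constants. $[a]_\nabla=a$, $[f(t_1,\dots,t_n)]_\nabla=f([t_1]_\nabla,\dots)$, $[a.t]_\nabla=\lambda a.[t]_\nabla$, $[\pi\cdot X]_\nabla=X([\pi\cdot b_1]_\nabla,\dots,[\pi\cdot b_m]_\nabla)$ with $\langle b_1,\dots,b_m\rangle$ the order-preserving sublist of $\langle a_1,\dots,a_n\rangle$ of atoms $a$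 with $a\#X\notin\nabla$, $X$ being the free $\lambda$-variable of type $[\nu_1]\to\cdots\to[\nu_m]\to[\tau]$ ($\lambda$-variables are determined by name and type). $[P]=\{\lambda a_1.\cdots\lambda a_n.[t]_\emptyset\stackrel{?}{=}\lambda a_1.\cdots\lambda a_n.[u]_\emptyset\mid t\stackrel{?}{\approx}u\in P\}$; $[\sigma]_\nabla=\bigcup_{X\in\mathrm{Dom}(\sigma)}[X\mapsto\lambda a_1.\cdots\lambda a_n.[\sigma(X)]_\nabla]$ (replacing the $n$-argument variable $X$). A $\lambda$-substitution $\theta$ solves $[P]$ if $\theta(s)=\theta(s')$ modulo $\alpha\beta\eta$ for every equation $s\stackrel{?}{=}s'$. *)

theory Defs
  imports "HOL-Combinatorics.Transposition"
begin

section \<open>Nominal terms\<close>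

text \<open>Sorts are built over sorts of atoms \<open>'n\<close> and sorts of data \<open>'d\<close>;
  \<open>AbsSort \<nu> \<tau>\<close> stands for \<open>\<langle>\<nu>\<rangle>\<tau>\<close>.\<close>

datatype ('n, 'd) nsort = AtomSort 'n | DataSort 'd | AbsSort 'n "('n, 'd) nsort"

record ('a, 'x, 'f, 'n, 'd) nsignature =
  atom_sort :: "'a \<Rightarrow> 'n"
  var_sort :: "'x \<Rightarrow> ('n, 'd) nsort"
  fun_arity :: "'f \<Rightarrow> ('n, 'd) nsort list \<times> ('n, 'd) nsort"

type_synonym 'a nperm = "('a \<times> 'a) list"

text \<open>The set function \<open>nt_atoms\<close> collects all atoms occurring in a term: as leaves, as binders,
  and in the swappings of suspended permutations.\<close>

datatype (nt_atoms: 'a, nt_vars: 'x, nt_funs: 'f) nterm =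
    Fn 'f "('a, 'x, 'f) nterm list"
  | Atm 'a
  | Abst 'a "('a, 'x, 'f) nterm"
  | Susp "'a nperm" 'x

text \<open>The head of the list is the swapping that is applied last.\<close>

definition perm_atom :: "'a nperm \<Rightarrow> 'a \<Rightarrow> 'a" where
  "perm_atom p c = foldr (\<lambda>(a, b). transpose a b) p c"

primrec swap_term :: "'a \<Rightarrow> 'a \<Rightarrow> ('a, 'x, 'f) nterm \<Rightarrow> ('a, 'x, 'f) nterm" where
  "swap_term a b (Fn f ts) = Fn f (map (swap_term a b) ts)"
| "swap_term a b (Atm c) = Atm (transpose a b c)"
| "swap_term a b (Abst c t) = Abst (transpose a b c) (swap_term a b t)"
| "swap_term a b (Susp p X) = Susp ((a, b) # p) X"

definition perm_term :: "'a nperm \<Rightarrow> ('a, 'x, 'f) nterm \<Rightarrow> ('a, 'x, 'f) nterm" where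
  "perm_term p t = foldr (\<lambda>(a, b). swap_term a b) p t"

definition sorted_perm :: "('a, 'x, 'f, 'n, 'd) nsignature \<Rightarrow> 'a nperm \<Rightarrow> bool" where
  "sorted_perm S p \<longleftrightarrow> (\<forall>(a, b) \<in> set p. atom_sort S a = atom_sort S b)"

inductive has_sort ::
  "('a, 'x, 'f, 'n, 'd) nsignature \<Rightarrow> ('a, 'x, 'f) nterm \<Rightarrow> ('n, 'd) nsort \<Rightarrow> bool"
  for S where
  "fun_arity S f = (\<tau>s, \<tau>) \<Longrightarrow> list_all2 (has_sort S) ts \<tau>s \<Longrightarrow> has_sort S (Fn f ts) \<tau>"
| "has_sort S (Atm a) (AtomSort (atom_sort S a))"
| "has_sort S t \<tau> \<Longrightarrow> has_sort S (Abst a t) (AbsSort (atom_sort S a) \<tau>)"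
| "sorted_perm S p \<Longrightarrow> has_sort S (Susp p X) (var_sort S X)"

text \<open>A freshness environment is a finite set of pairs \<open>(a, X)\<close>, each standing for \<open>a # X\<close>.
  The inverse of a permutation \<open>p\<close> is \<open>rev p\<close>.\<close>

inductive fresh :: "('a \<times> 'x) set \<Rightarrow> 'a \<Rightarrow> ('a, 'x, 'f) nterm \<Rightarrow> bool"
  for nabla where
  "a \<noteq> a' \<Longrightarrow> fresh nabla a (Atm a')"
| "(perm_atom (rev p) a, X) \<in> nabla \<Longrightarrow> fresh nabla a (Susp p X)"
| "\<forall>t \<in> set ts. fresh nabla a t \<Longrightarrow> fresh nabla a (Fn f ts)"
| "fresh nabla a (Abst a t)"
| "a \<noteq> a' \<Longrightarrow> fresh nabla a t \<Longrightarrow> fresh nabla a (Abst a' t)"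

inductive nom_eq :: "('a \<times> 'x) set \<Rightarrow> ('a, 'x, 'f) nterm \<Rightarrow> ('a, 'x, 'f) nterm \<Rightarrow> bool"
  for nabla where
  "nom_eq nabla (Atm a) (Atm a)"
| "\<forall>a. perm_atom p a \<noteq> perm_atom p' a \<longrightarrow> (a, X) \<in> nabla \<Longrightarrow>
     nom_eq nabla (Susp p X) (Susp p' X)"
| "list_all2 (nom_eq nabla) ts ts' \<Longrightarrow> nom_eq nabla (Fn f ts) (Fn f ts')"
| "nom_eq nabla t t' \<Longrightarrow> nom_eq nabla (Abst a t) (Abst a t')"
| "a \<noteq> a' \<Longrightarrow> nom_eq nabla t (swap_term a a' t') \<Longrightarrow> fresh nabla a t' \<Longrightarrow>
     nom_eq nabla (Abst a t) (Abst a' t')"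

type_synonym ('a, 'x, 'f) nsubst = "'x \<Rightarrow> ('a, 'x, 'f) nterm option"

primrec nsubst_app :: "('a, 'x, 'f) nsubst \<Rightarrow> ('a, 'x, 'f) nterm \<Rightarrow> ('a, 'x, 'f) nterm" where
  "nsubst_app \<sigma> (Fn f ts) = Fn f (map (nsubst_app \<sigma>) ts)"
| "nsubst_app \<sigma> (Atm a) = Atm a"
| "nsubst_app \<sigma> (Abst a t) = Abst a (nsubst_app \<sigma> t)"
| "nsubst_app \<sigma> (Susp p X) = (case \<sigma> X of None \<Rightarrow> Susp p X | Some t \<Rightarrow> perm_term p t)"

definition nominal_subst ::
  "('a, 'x, 'f, 'n, 'd) nsignature \<Rightarrow> ('a, 'x, 'f) nsubst \<Rightarrow> bool" where
  "nominal_subst S \<sigma> \<longleftrightarrow>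
     finite (dom \<sigma>) \<and> (\<forall>X t. \<sigma> X = Some t \<longrightarrow> has_sort S t (var_sort S X))"

type_synonym ('a, 'x, 'f) nproblem = "(('a, 'x, 'f) nterm \<times> ('a, 'x, 'f) nterm) set"

definition nominal_problem ::
  "('a, 'x, 'f, 'n, 'd) nsignature \<Rightarrow> ('a, 'x, 'f) nproblem \<Rightarrow> bool" where
  "nominal_problem S P \<longleftrightarrow>
     finite P \<and> (\<forall>(t, u) \<in> P. \<exists>\<tau>. has_sort S t \<tau> \<and> has_sort S u \<tau>)"

definition problem_vars :: "('a, 'x, 'f) nproblem \<Rightarrow> 'x set" where
  "problem_vars P = (\<Union>(t, u) \<in> P. nt_vars t \<union> nt_vars u)"

definition problem_atoms :: "('a, 'x, 'f) nproblem \<Rightarrow> 'a set" where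
  "problem_atoms P = (\<Union>(t, u) \<in> P. nt_atoms t \<union> nt_atoms u)"

definition subst_atoms :: "('a, 'x, 'f) nsubst \<Rightarrow> 'a set" where
  "subst_atoms \<sigma> = (\<Union>t \<in> ran \<sigma>. nt_atoms t)"

definition nominal_solves ::
  "('a \<times> 'x) set \<Rightarrow> ('a, 'x, 'f) nsubst \<Rightarrow> ('a, 'x, 'f) nproblem \<Rightarrow> bool" where
  "nominal_solves nabla \<sigma> P \<longleftrightarrow>
     (\<forall>(t, u) \<in> P. nom_eq nabla (nsubst_app \<sigma> t) (nsubst_app \<sigma> u))"


section \<open>Simply typed lambda-terms\<close>

datatype 'b ltype = Base 'b | Arr "'b ltype" "'b ltype"

text \<open>A lambda-variable is a name together with a type. Free variables are such variables, bound
  ones are de Bruijn indices, so that equality of terms is equality modulo \<open>\<alpha>\<close>. Abstraction over a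
  (named) variable is the function \<open>lam\<close> below.\<close>

type_synonym ('v, 'b) lvar = "'v \<times> 'b ltype"

datatype ('v, 'c, 'b) lterm =
    LVar "('v, 'b) lvar"
  | LConst 'c
  | LBound nat
  | LApp "('v, 'c, 'b) lterm" "('v, 'c, 'b) lterm"
  | LAbs "'b ltype" "('v, 'c, 'b) lterm"

primrec lift :: "nat \<Rightarrow> ('v, 'c, 'b) lterm \<Rightarrow> ('v, 'c, 'b) lterm" where
  "lift k (LVar x) = LVar x"
| "lift k (LConst c) = LConst c"
| "lift k (LBound i) = LBound (if i < k then i else Suc i)"
| "lift k (LApp s t) = LApp (lift k s) (lift k t)"
| "lift k (LAbs T t) = LAbs T (lift (Suc k) t)"

primrec inst :: "nat \<Rightarrow> ('v, 'c, 'b) lterm \<Rightarrow> ('v, 'c, 'b) lterm \<Rightarrow> ('v, 'c, 'b) lterm" where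
  "inst k u (LVar x) = LVar x"
| "inst k u (LConst c) = LConst c"
| "inst k u (LBound i) = (if i < k then LBound i else if i = k then u else LBound (i - 1))"
| "inst k u (LApp s t) = LApp (inst k u s) (inst k u t)"
| "inst k u (LAbs T t) = LAbs T (inst (Suc k) (lift 0 u) t)"

primrec bind_var :: "nat \<Rightarrow> ('v, 'b) lvar \<Rightarrow> ('v, 'c, 'b) lterm \<Rightarrow> ('v, 'c, 'b) lterm" where
  "bind_var k x (LVar y) = (if y = x then LBound k else LVar y)"
| "bind_var k x (LConst c) = LConst c"
| "bind_var k x (LBound i) = LBound (if i < k then i else Suc i)"
| "bind_var k x (LApp s t) = LApp (bind_var k x s) (bind_var k x t)"
| "bind_var k x (LAbs T t) = LAbs T (bind_var (Suc k) x t)"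

definition lam :: "('v, 'b) lvar \<Rightarrow> ('v, 'c, 'b) lterm \<Rightarrow> ('v, 'c, 'b) lterm" where
  "lam x t = LAbs (snd x) (bind_var 0 x t)"

definition lams :: "('v, 'b) lvar list \<Rightarrow> ('v, 'c, 'b) lterm \<Rightarrow> ('v, 'c, 'b) lterm" where
  "lams xs t = foldr lam xs t"

definition apps :: "('v, 'c, 'b) lterm \<Rightarrow> ('v, 'c, 'b) lterm list \<Rightarrow> ('v, 'c, 'b) lterm" where
  "apps t us = foldl LApp t us"

definition arrs :: "'b ltype list \<Rightarrow> 'b ltype \<Rightarrow> 'b ltype" where
  "arrs Ts T = foldr Arr Ts T"

inductive has_type ::
  "('c \<Rightarrow> 'b ltype) \<Rightarrow> 'b ltype list \<Rightarrow> ('v, 'c, 'b) lterm \<Rightarrow> 'b ltype \<Rightarrow> bool"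
  for C where
  "has_type C \<Gamma> (LVar x) (snd x)"
| "has_type C \<Gamma> (LConst c) (C c)"
| "i < length \<Gamma> \<Longrightarrow> has_type C \<Gamma> (LBound i) (\<Gamma> ! i)"
| "has_type C \<Gamma> s (Arr T U) \<Longrightarrow> has_type C \<Gamma> t T \<Longrightarrow> has_type C \<Gamma> (LApp s t) U"
| "has_type C (T # \<Gamma>) t U \<Longrightarrow> has_type C \<Gamma> (LAbs T t) (Arr T U)"

text \<open>\<open>\<beta>\<eta>\<close>-equality of typed terms. The typing premises matter: on raw terms with typed binders
  untyped \<open>\<eta>\<close> would identify identity functions of different types.\<close>

inductive beta_eta_eq ::
  "('c \<Rightarrow> 'b ltype) \<Rightarrow> 'b ltype list \<Rightarrow> ('v, 'c, 'b) lterm \<Rightarrow> ('v, 'c, 'b) lterm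
     \<Rightarrow> 'b ltype \<Rightarrow> bool"
  for C where
  refl: "has_type C \<Gamma> t T \<Longrightarrow> beta_eta_eq C \<Gamma> t t T"
| sym: "beta_eta_eq C \<Gamma> s t T \<Longrightarrow> beta_eta_eq C \<Gamma> t s T"
| trans: "beta_eta_eq C \<Gamma> s t T \<Longrightarrow> beta_eta_eq C \<Gamma> t u T \<Longrightarrow> beta_eta_eq C \<Gamma> s u T"
| app: "beta_eta_eq C \<Gamma> s s' (Arr T U) \<Longrightarrow> beta_eta_eq C \<Gamma> t t' T \<Longrightarrow>
     beta_eta_eq C \<Gamma> (LApp s t) (LApp s' t') U"
| abs: "beta_eta_eq C (T # \<Gamma>) t t' U \<Longrightarrow> beta_eta_eq C \<Gamma> (LAbs T t) (LAbs T t') (Arr T U)"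
| beta: "has_type C (T # \<Gamma>) t U \<Longrightarrow> has_type C \<Gamma> u T \<Longrightarrow>
     beta_eta_eq C \<Gamma> (LApp (LAbs T t) u) (inst 0 u t) U"
| eta: "has_type C \<Gamma> t (Arr T U) \<Longrightarrow>
     beta_eta_eq C \<Gamma> (LAbs T (LApp (lift 0 t) (LBound 0))) t (Arr T U)"

type_synonym ('v, 'c, 'b) lsubst = "('v, 'b) lvar \<Rightarrow> ('v, 'c, 'b) lterm option"

primrec lsubst_app :: "('v, 'c, 'b) lsubst \<Rightarrow> ('v, 'c, 'b) lterm \<Rightarrow> ('v, 'c, 'b) lterm" where
  "lsubst_app \<theta> (LVar x) = (case \<theta> x of None \<Rightarrow> LVar x | Some u \<Rightarrow> u)"
| "lsubst_app \<theta> (LConst c) = LConst c"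
| "lsubst_app \<theta> (LBound i) = LBound i"
| "lsubst_app \<theta> (LApp s t) = LApp (lsubst_app \<theta> s) (lsubst_app \<theta> t)"
| "lsubst_app \<theta> (LAbs T t) = LAbs T (lsubst_app (\<lambda>x. map_option (lift 0) (\<theta> x)) t)"

type_synonym ('v, 'c, 'b) lproblem = "(('v, 'c, 'b) lterm \<times> ('v, 'c, 'b) lterm) set"

definition lambda_solves ::
  "('c \<Rightarrow> 'b ltype) \<Rightarrow> ('v, 'c, 'b) lsubst \<Rightarrow> ('v, 'c, 'b) lproblem \<Rightarrow> bool" where
  "lambda_solves C \<theta> Q \<longleftrightarrow>
     (\<forall>(s, s') \<in> Q. \<exists>T. beta_eta_eq C [] (lsubst_app \<theta> s) (lsubst_app \<theta> s') T)"



section \<open>Translation\<close>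

text \<open>Base types are the sorts of atoms and of data; names of lambda-variables are the atoms
  (\<open>Inl\<close>) and the nominal variables (\<open>Inr\<close>).\<close>

primrec tr_sort :: "('n, 'd) nsort \<Rightarrow> ('n + 'd) ltype" where
  "tr_sort (AtomSort \<nu>) = Base (Inl \<nu>)"
| "tr_sort (DataSort \<delta>) = Base (Inr \<delta>)"
| "tr_sort (AbsSort \<nu> \<tau>) = Arr (Base (Inl \<nu>)) (tr_sort \<tau>)"

definition tr_const_type :: "('a, 'x, 'f, 'n, 'd) nsignature \<Rightarrow> 'f \<Rightarrow> ('n + 'd) ltype" where
  "tr_const_type S f = (case fun_arity S f of (\<tau>s, \<tau>) \<Rightarrow> arrs (map tr_sort \<tau>s) (tr_sort \<tau>))"

definition atom_var :: "('a, 'x, 'f, 'n, 'd) nsignature \<Rightarrow> 'a \<Rightarrow> ('a + 'x, 'n + 'd) lvar" where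
  "atom_var S a = (Inl a, tr_sort (AtomSort (atom_sort S a)))"

definition unk_var ::
  "('a, 'x, 'f, 'n, 'd) nsignature \<Rightarrow> 'a list \<Rightarrow> 'x \<Rightarrow> ('a + 'x, 'n + 'd) lvar" where
  "unk_var S bs X =
     (Inr X, arrs (map (\<lambda>b. tr_sort (AtomSort (atom_sort S b))) bs) (tr_sort (var_sort S X)))"

primrec tr_term ::
  "('a, 'x, 'f, 'n, 'd) nsignature \<Rightarrow> 'a list \<Rightarrow> ('a \<times> 'x) set \<Rightarrow> ('a, 'x, 'f) nterm
     \<Rightarrow> ('a + 'x, 'f, 'n + 'd) lterm" where
  "tr_term S as nabla (Fn f ts) = apps (LConst f) (map (tr_term S as nabla) ts)"
| "tr_term S as nabla (Atm a) = LVar (atom_var S a)"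
| "tr_term S as nabla (Abst a t) = lam (atom_var S a) (tr_term S as nabla t)"
| "tr_term S as nabla (Susp p X) =
     (let bs = filter (\<lambda>a. (a, X) \<notin> nabla) as
      in apps (LVar (unk_var S bs X)) (map (\<lambda>b. LVar (atom_var S (perm_atom p b))) bs))"

definition tr_closed ::
  "('a, 'x, 'f, 'n, 'd) nsignature \<Rightarrow> 'a list \<Rightarrow> ('a \<times> 'x) set \<Rightarrow> ('a, 'x, 'f) nterm
     \<Rightarrow> ('a + 'x, 'f, 'n + 'd) lterm" where
  "tr_closed S as nabla t = lams (map (atom_var S) as) (tr_term S as nabla t)"

definition tr_problem ::
  "('a, 'x, 'f, 'n, 'd) nsignature \<Rightarrow> 'a list \<Rightarrow> ('a, 'x, 'f) nproblem
     \<Rightarrow> ('a + 'x, 'f, 'n + 'd) lproblem" where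
  "tr_problem S as P = (\<lambda>(t, u). (tr_closed S as {} t, tr_closed S as {} u)) ` P"

text \<open>Only the variable \<open>X\<close> that takes all atoms of the list as arguments is replaced, not the
  variables of the same name and fewer arguments.\<close>

definition tr_subst ::
  "('a, 'x, 'f, 'n, 'd) nsignature \<Rightarrow> 'a list \<Rightarrow> ('a \<times> 'x) set \<Rightarrow> ('a, 'x, 'f) nsubst
     \<Rightarrow> ('a + 'x, 'f, 'n + 'd) lsubst" where
  "tr_subst S as nabla \<sigma> y =
     (case fst y of
        Inl a \<Rightarrow> None
      | Inr X \<Rightarrow> if y = unk_var S as X then map_option (tr_closed S as nabla) (\<sigma> X) else None)"

end

theory Submission
  imports Defs
begin

text \<open>
  Applying \<open>[\<sigma>]\<^sub>\<nabla>\<close> to \<open>[t]\<^sub>\<emptyset>\<close> and \<open>\<beta>\<close>-reducing at the unknowns gives \<open>[\<sigma>(t)]\<^sub>\<nabla>\<close>, because a permutation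
  of the atoms acts on a translated term as a renaming of its \<open>\<lambda>\<close>-variables. It remains to compare
  \<open>\<nabla> \<turnstile> t \<approx> u\<close> with \<open>[t]\<^sub>\<nabla> = [u]\<^sub>\<nabla>\<close> modulo \<open>\<beta>\<eta>\<close>. For \<open>\<alpha>\<close>-equality this is a direct induction, since
  \<open>a # t\<close> says that \<open>a\<close> is not free in \<open>[t]\<^sub>\<nabla>\<close>. Translated terms are \<open>\<beta>\<close>-normal, and every head symbol
  has exactly as many arguments as its arity; an \<open>\<eta>\<close>-contraction removes one of them and can
  therefore be undone in only one way, so by confluence \<open>\<beta>\<eta>\<close>-equal translated terms are already
  \<open>\<alpha>\<close>-equal.
\<close>

section \<open>Confluence\<close>

lemma lift_lift: "i \<le> k \<Longrightarrow> lift (Suc k) (lift i t) = lift i (lift k t)"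
  by (induction t arbitrary: i k) auto

lemma inst_lift [simp]: "inst k u (lift k t) = t"
  by (induction t arbitrary: k u) auto

text \<open>Used where a \<beta>- and an \<eta>-redex overlap: contracting
  \<open>LApp (lift 0 t) (LBound 0)\<close> for an abstraction \<open>t\<close> restores the body of
  \<open>t\<close>.\<close>

lemma inst_bound_lift [simp]: "inst k (LBound k) (lift (Suc k) t) = t"
  by (induction t arbitrary: k) auto

lemma lift_inject [simp]: "lift k s = lift k t \<longleftrightarrow> s = t"
  by (metis inst_lift)

lemma lift_inst: "i \<le> k \<Longrightarrow> lift k (inst i u t) = inst i (lift k u) (lift (Suc k) t)"
  by (induction t arbitrary: i k u) (auto simp: lift_lift)

lemma inst_lift_less: "i \<le> k \<Longrightarrow> inst (Suc k) (lift i u) (lift i t) = lift i (inst k u t)"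
  by (induction t arbitrary: i k u) (auto simp: lift_lift[symmetric])

lemma inst_inst:
  "i \<le> k \<Longrightarrow> inst k u (inst i v t) = inst i (inst k u v) (inst (Suc k) (lift i u) t)"
  by (induction t arbitrary: i k u v) (auto simp: lift_lift[symmetric] inst_lift_less)

text \<open>Both skipped indices are absent from such a term, so the two lifts can be undone
  together. This exposes an \<eta>-redex below a lift.\<close>

lemma lift_eq_lift:
  "i \<le> k \<Longrightarrow> lift (Suc k) s = lift i t \<Longrightarrow> \<exists>u. s = lift i u \<and> t = lift k u"
proof (induction s arbitrary: i k t)
  case (LBound j)
  then obtain j' where t: "t = LBound j'" by (cases t) auto
  show ?case
  proof (cases "j < i")
    case True
    then show ?thesis using LBound t by (intro exI[of _ "LBound j"]) (auto split: if_splits)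
  next
    case False
    then show ?thesis using LBound t by (intro exI[of _ "LBound (j - 1)"]) (auto split: if_splits)
  qed
next
  case (LApp s1 s2)
  from LApp.prems obtain t1 t2 where t: "t = LApp t1 t2" by (cases t) auto
  with LApp.prems LApp.IH(1)[of i k t1] LApp.IH(2)[of i k t2] obtain u1 u2
    where "s1 = lift i u1 \<and> t1 = lift k u1" "s2 = lift i u2 \<and> t2 = lift k u2" by auto
  then show ?case using t by (intro exI[of _ "LApp u1 u2"]) simp
next
  case (LAbs T s)
  from LAbs.prems obtain t' where t: "t = LAbs T t'" by (cases t) auto
  with LAbs.prems LAbs.IH[of "Suc i" "Suc k" t'] obtain u
    where "s = lift (Suc i) u \<and> t' = lift (Suc k) u" by auto
  then show ?case using t by (intro exI[of _ "LAbs T u"]) simp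
next
  case (LVar x)
  then show ?case by (cases t) (auto intro: exI[of _ "LVar x"])
next
  case (LConst x)
  then show ?case by (cases t) (auto intro: exI[of _ "LConst x"])
qed

text \<open>Binder types are ignored: a well-typed term has the same type on both binders of
  \<open>\<lambda>x:T. (\<lambda>y:U. t) x\<close>, but raw terms do not, and there the \<open>\<beta>\<close>- and the \<open>\<eta>\<close>-reduct would
  otherwise not be joinable.\<close>

inductive par :: "('v, 'c, 'b) lterm \<Rightarrow> ('v, 'c, 'b) lterm \<Rightarrow> bool" where
  par_var: "par (LVar x) (LVar x)"
| par_const: "par (LConst c) (LConst c)"
| par_bound: "par (LBound i) (LBound i)"
| par_app: "par s s' \<Longrightarrow> par t t' \<Longrightarrow> par (LApp s t) (LApp s' t')"
| par_abs: "par t t' \<Longrightarrow> par (LAbs T t) (LAbs U t')"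
| par_beta: "par s s' \<Longrightarrow> par t t' \<Longrightarrow> par (LApp (LAbs T s) t) (inst 0 t' s')"
| par_eta: "par s s' \<Longrightarrow> par (LAbs T (LApp (lift 0 s) (LBound 0))) s'"

inductive_cases par_appE: "par (LApp s t) u"
inductive_cases par_absE: "par (LAbs T s) u"
inductive_cases par_boundE: "par (LBound i) u"
inductive_cases par_varE: "par (LVar x) u"
inductive_cases par_constE: "par (LConst c) u"

section \<open>Parallel reduction and its diamond property\<close>

lemma par_refl [simp]: "par t t"
  by (induction t) (auto intro: par.intros)

lemma par_lift: "par s t \<Longrightarrow> par (lift k s) (lift k t)"
proof (induction arbitrary: k rule: par.induct)
  case (par_beta s s' t t' T)
  then show ?case by (auto simp: lift_inst intro: par.intros)
next
  case (par_eta s s' T)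
  then show ?case by (auto simp: lift_lift intro: par.intros)
qed (auto intro: par.intros)

lemma par_inst: "par s s' \<Longrightarrow> par t t' \<Longrightarrow> par (inst k t s) (inst k t' s')"
proof (induction arbitrary: k t t' rule: par.induct)
  case (par_beta s s' u u' T)
  then show ?case by (auto simp: inst_inst intro!: par.par_beta par_lift)
next
  case (par_eta s s' T)
  then show ?case by (auto simp: inst_lift_less intro!: par.par_eta)
qed (auto intro!: par_app par_abs par_lift)

text \<open>Reduction creates no free index. This keeps the side condition of \<eta>, encoded by
  \<open>lift 0\<close>, stable under reduction.\<close>

lemma par_lift_inv: "par (lift k s) y \<Longrightarrow> \<exists>y'. y = lift k y' \<and> par s y'"
proof (induction "lift k s" y arbitrary: k s rule: par.induct)
  case (par_var x)
  then have "s = LVar x" by (cases s) auto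
  then show ?case by (auto intro!: exI[of _ "LVar x"])
next
  case (par_const x)
  then have "s = LConst x" by (cases s) auto
  then show ?case by (auto intro!: exI[of _ "LConst x"])
next
  case (par_bound i)
  then show ?case by (intro exI[of _ s]) auto
next
  case (par_app s1 s1' s2 s2')
  then obtain t1 t2 where s: "s = LApp t1 t2" "s1 = lift k t1" "s2 = lift k t2" by (cases s) auto
  from par_app(2)[OF s(2)] par_app(4)[OF s(3)] obtain y1 y2 where
    "s1' = lift k y1" "par t1 y1" "s2' = lift k y2" "par t2 y2" by blast
  then show ?case using s by (intro exI[of _ "LApp y1 y2"]) (auto intro: par.intros)
next
  case (par_abs t t' T U)
  then obtain t0 where s: "s = LAbs T t0" "t = lift (Suc k) t0" by (cases s) auto
  from par_abs(2)[OF s(2)] obtain y where "t' = lift (Suc k) y" "par t0 y" by blast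
  then show ?case using s by (intro exI[of _ "LAbs U y"]) (auto intro: par.intros)
next
  case (par_beta s1 s1' s2 s2' T)
  then obtain t1 t2 where "s = LApp t1 t2" "LAbs T s1 = lift k t1" "s2 = lift k t2"
    by (cases s) auto
  moreover then obtain t3 where "t1 = LAbs T t3" "s1 = lift (Suc k) t3" by (cases t1) auto
  ultimately have s: "s = LApp (LAbs T t3) t2" "s1 = lift (Suc k) t3" "s2 = lift k t2" by auto
  from par_beta(2)[OF s(2)] par_beta(4)[OF s(3)] obtain y1 y2 where
    "s1' = lift (Suc k) y1" "par t3 y1" "s2' = lift k y2" "par t2 y2" by blast
  then show ?case using s
    by (intro exI[of _ "inst 0 y2 y1"]) (auto simp: lift_inst intro: par.intros)
next
  case (par_eta s1 s1' T)
  then obtain t0 where t0: "s = LAbs T t0" "lift (Suc k) t0 = LApp (lift 0 s1) (LBound 0)"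
    by (cases s) auto
  then obtain t1 t2 where t: "t0 = LApp t1 t2" "lift (Suc k) t1 = lift 0 s1"
    "lift (Suc k) t2 = LBound 0"
    by (cases t0) auto
  have "t2 = LBound 0" using t(3) by (cases t2) (auto split: if_splits)
  moreover obtain u where "t1 = lift 0 u" "s1 = lift k u"
    using lift_eq_lift[OF _ t(2)] by blast
  ultimately have s: "s = LAbs T (LApp (lift 0 u) (LBound 0))" "s1 = lift k u"
    using t0(1) t(1) by simp_all
  from par_eta(2)[OF s(2)] obtain y where "s1' = lift k y" "par u y" by blast
  then show ?case using s(1) by (blast intro: par.par_eta)
qed

lemma size_lift [simp]: "size (lift k t) = size t"
  by (induction t arbitrary: k) auto

text \<open>A complete development in the style of Takahashi, given by its existence. The induction
  is on size because an \<eta>-redex contains its function part only as \<open>lift 0 s0\<close>, so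
  \<open>s0\<close> itself is no subterm.\<close>

lemma par_complete_development: "\<exists>d. \<forall>s. par t s \<longrightarrow> par s d"
proof (induction t rule: measure_induct_rule[of size])
  case (less t)
  show ?case
  proof (cases t)
    case (LApp s u)
    obtain d e where d: "\<And>y. par s y \<Longrightarrow> par y d" and e: "\<And>y. par u y \<Longrightarrow> par y e"
      using less[of s] less[of u] LApp by auto
    show ?thesis
    proof (cases "\<exists>T b. s = LAbs T b")
      case False
      then show ?thesis using LApp d e
        by (intro exI[of _ "LApp d e"]) (auto elim!: par_appE intro: par.intros)
    next
      case True
      then obtain T b where s: "s = LAbs T b" by blast
      obtain c where c: "\<And>y. par b y \<Longrightarrow> par y c" using less[of b] LApp s by auto
      have "par x (inst 0 e c)" if x: "par t x" for x
      proof -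
        consider (app) U b' u' where "x = LApp (LAbs U b') u'" "par b b'" "par u u'"
          | (eta) s0 y u' where "x = LApp y u'" "b = LApp (lift 0 s0) (LBound 0)" "par s0 y" "par u u'"
          | (beta) b' u' where "x = inst 0 u' b'" "par b b'" "par u u'"
          using x unfolding LApp s by (auto elim!: par_appE par_absE)
        then show ?thesis
        proof cases
          case app
          then show ?thesis using c e by (blast intro: par_beta)
        next
          case eta
          \<comment> \<open>The function part is an \<eta>-redex itself: instantiating its body with
            the argument gives the same application as contracting it.\<close>
          have "par (LApp (lift 0 y) (LBound 0)) c"
            using eta c by (blast intro: par_app par_refl par_lift)
          from par_inst[OF this e[OF \<open>par u u'\<close>], of 0] show ?thesis using eta by simp
        next
          case beta
          then show ?thesis using c e by (blast intro: par_inst)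
        qed
      qed
      then show ?thesis by blast
    qed
  next
    case (LAbs T b)
    show ?thesis
    proof (cases "\<exists>s0. b = LApp (lift 0 s0) (LBound 0)")
      case False
      obtain d where "\<And>y. par b y \<Longrightarrow> par y d" using less[of b] LAbs by auto
      then show ?thesis using False LAbs
        by (intro exI[of _ "LAbs T d"]) (auto elim!: par_absE intro: par.intros)
    next
      case True
      then obtain s0 where b: "b = LApp (lift 0 s0) (LBound 0)" by blast
      obtain d where d: "\<And>y. par s0 y \<Longrightarrow> par y d" using less[of s0] LAbs b by auto
      have "par x d" if x: "par t x" for x
      proof -
        consider (eta) "par s0 x"
          | (app) U y where "x = LAbs U (LApp y (LBound 0))" "par (lift 0 s0) y"
          | (beta) U V c c' where "x = LAbs U (inst 0 (LBound 0) c')" "lift 0 s0 = LAbs V c" "par c c'"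
          using x unfolding LAbs b by (auto elim!: par_absE par_appE par_boundE)
        then show ?thesis
        proof cases
          case eta
          then show ?thesis by (rule d)
        next
          case app
          then obtain y0 where "y = lift 0 y0" "par s0 y0" using par_lift_inv by blast
          then show ?thesis using app d by (blast intro: par_eta)
        next
          case beta
          \<comment> \<open>The inner application is a \<beta>-redex because \<open>s0\<close> is an
            abstraction; contracting it yields a reduct of \<open>s0\<close> again, up to the binder
            type.\<close>
          then obtain c0 where c0: "s0 = LAbs V c0" "c = lift (Suc 0) c0" by (cases s0) auto
          then obtain c1 where "c' = lift (Suc 0) c1" "par c0 c1"
            using beta par_lift_inv by blast
          then have "x = LAbs U c1" "par s0 (LAbs U c1)" using beta c0 by (auto intro: par_abs)
          then show ?thesis using d by blast
        qed
      qed
      then show ?thesis by blast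
    qed
  qed (auto elim: par_varE par_constE par_boundE)
qed

section \<open>Confluence and joinability\<close>

definition joinable :: "('v, 'c, 'b) lterm \<Rightarrow> ('v, 'c, 'b) lterm \<Rightarrow> bool" where
  "joinable s t \<longleftrightarrow> (\<exists>w. par\<^sup>*\<^sup>* s w \<and> par\<^sup>*\<^sup>* t w)"

lemma par_strip: "par\<^sup>*\<^sup>* s t \<Longrightarrow> par s u \<Longrightarrow> \<exists>w. par t w \<and> par\<^sup>*\<^sup>* u w"
proof (induction rule: rtranclp_induct)
  case (step y z)
  then obtain w where w: "par y w" "par\<^sup>*\<^sup>* u w" by blast
  obtain d where "par z d" "par w d" using par_complete_development[of y] w step by blast
  then show ?case using w by (meson rtranclp.rtrancl_into_rtrancl)
qed auto

lemma par_confluent: "par\<^sup>*\<^sup>* s t \<Longrightarrow> par\<^sup>*\<^sup>* s u \<Longrightarrow> joinable t u"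
proof (induction rule: rtranclp_induct)
  case base
  then show ?case unfolding joinable_def by blast
next
  case (step y z)
  then obtain w where w: "par\<^sup>*\<^sup>* y w" "par\<^sup>*\<^sup>* u w" unfolding joinable_def by blast
  obtain v where "par w v" "par\<^sup>*\<^sup>* z v" using par_strip[OF w(1) step(2)] by blast
  then show ?case using w unfolding joinable_def by (meson rtranclp.rtrancl_into_rtrancl)
qed

lemma joinable_sym: "joinable s t \<Longrightarrow> joinable t s"
  unfolding joinable_def by blast

lemma joinable_trans: "joinable s t \<Longrightarrow> joinable t u \<Longrightarrow> joinable s u"
  unfolding joinable_def by (meson joinable_def par_confluent rtranclp_trans)

lemma par_joinable: "par s t \<Longrightarrow> joinable s t"
  unfolding joinable_def by blast

lemma pars_app:
  assumes "par\<^sup>*\<^sup>* s s'" "par\<^sup>*\<^sup>* t t'"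
  shows "par\<^sup>*\<^sup>* (LApp s t) (LApp s' t')"
proof -
  have "par\<^sup>*\<^sup>* (LApp s t) (LApp s' t)"
    using assms(1) by induction (auto intro: par_app par_refl rtranclp.rtrancl_into_rtrancl)
  also have "par\<^sup>*\<^sup>* \<dots> (LApp s' t')"
    using assms(2) by induction (auto intro: par_app par_refl rtranclp.rtrancl_into_rtrancl)
  finally show ?thesis .
qed

lemma pars_abs: "par\<^sup>*\<^sup>* t t' \<Longrightarrow> par\<^sup>*\<^sup>* (LAbs T t) (LAbs T t')"
  by (induction rule: rtranclp_induct) (auto intro: par_abs rtranclp.rtrancl_into_rtrancl)

text \<open>The Church-Rosser property on raw terms: types are dropped, and the case of transitivity
  rests on confluence.\<close>

lemma beta_eta_eq_joinable: "beta_eta_eq C \<Gamma> s t T \<Longrightarrow> joinable s t"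
proof (induction rule: beta_eta_eq.induct)
  case (sym \<Gamma> s t T)
  then show ?case by (blast intro: joinable_sym)
next
  case (trans \<Gamma> s t T u)
  then show ?case by (blast intro: joinable_trans)
next
  case (app \<Gamma> s s' T U t t')
  then show ?case unfolding joinable_def by (meson pars_app)
next
  case (abs T \<Gamma> t t' U)
  then show ?case unfolding joinable_def by (meson pars_abs)
qed (auto intro!: par_joinable par_refl par_beta par_eta)

section \<open>Arity-respecting normal forms\<close>

primrec nargs :: "('v, 'c, 'b) lterm \<Rightarrow> nat" where
  "nargs (LVar x) = 0"
| "nargs (LConst c) = 0"
| "nargs (LBound i) = 0"
| "nargs (LApp s t) = Suc (nargs s)"
| "nargs (LAbs T t) = 0"

primrec nlams :: "('v, 'c, 'b) lterm \<Rightarrow> nat" where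
  "nlams (LVar x) = 0"
| "nlams (LConst c) = 0"
| "nlams (LBound i) = 0"
| "nlams (LApp s t) = 0"
| "nlams (LAbs T t) = Suc (nlams t)"

lemma nargs_lift [simp]: "nargs (lift k t) = nargs t"
  by (induction t arbitrary: k) auto

text \<open>\<open>par\<close> may change binder types, so full terms are recovered only up to them;
  all binders get one dummy type.\<close>

primrec erase :: "('v, 'c, 'b) lterm \<Rightarrow> ('v, 'c, 'b) lterm" where
  "erase (LVar x) = LVar x"
| "erase (LConst c) = LConst c"
| "erase (LBound i) = LBound i"
| "erase (LApp s t) = LApp (erase s) (erase t)"
| "erase (LAbs T t) = LAbs (Base undefined) (erase t)"

context
  fixes arv :: "('v, 'b) lvar \<Rightarrow> nat" and arc :: "'c \<Rightarrow> nat"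
begin

text \<open>\<open>full m t\<close>: \<open>t\<close> is \<open>\<beta>\<close>-normal and, when applied to \<open>m\<close> arguments, gives every head exactly
  as many arguments as its arity.\<close>

primrec full :: "nat \<Rightarrow> ('v, 'c, 'b) lterm \<Rightarrow> bool" where
  "full m (LVar x) \<longleftrightarrow> m = arv x"
| "full m (LConst c) \<longleftrightarrow> m = arc c"
| "full m (LBound i) \<longleftrightarrow> m = 0"
| "full m (LApp s t) \<longleftrightarrow> full (Suc m) s \<and> full 0 t"
| "full m (LAbs T t) \<longleftrightarrow> m = 0 \<and> full 0 t"

text \<open>\<open>eta_variant m r w\<close>: \<open>w\<close> arises from the full term \<open>r\<close> by \<open>\<eta>\<close>-contractions and changes of
  binder types.\<close>

inductive eta_variant :: "nat \<Rightarrow> ('v, 'c, 'b) lterm \<Rightarrow> ('v, 'c, 'b) lterm \<Rightarrow> bool" where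
  ev_var: "m = arv x \<Longrightarrow> eta_variant m (LVar x) (LVar x)"
| ev_const: "m = arc c \<Longrightarrow> eta_variant m (LConst c) (LConst c)"
| ev_bound: "eta_variant 0 (LBound i) (LBound i)"
| ev_app: "eta_variant (Suc m) r w \<Longrightarrow> eta_variant 0 s t \<Longrightarrow> eta_variant m (LApp r s) (LApp w t)"
| ev_abs: "eta_variant 0 r w \<Longrightarrow> eta_variant 0 (LAbs T r) (LAbs U w)"
| ev_eta: "eta_variant 0 r (LApp (lift 0 w) (LBound 0)) \<Longrightarrow> eta_variant 0 (LAbs T r) w"

inductive_cases ev_absE: "eta_variant m r (LAbs U w)"
inductive_cases ev_appE: "eta_variant m r (LApp w t)"
inductive_cases ev_varE: "eta_variant m r (LVar x)"
inductive_cases ev_constE: "eta_variant m r (LConst x)"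
inductive_cases ev_boundE: "eta_variant m r (LBound x)"

section \<open>Recovering a full term from an \<eta>-variant\<close>

lemma full_eta_variant: "full m r \<Longrightarrow> eta_variant m r r"
  by (induction r arbitrary: m) (auto intro: eta_variant.intros)

text \<open>A variant in function position has \<open>m > 0\<close> and is therefore no abstraction,
  so no \<beta>-step applies: only \<eta>-contractions and changes of binder types remain.\<close>

lemma eta_variant_par: "eta_variant m r w \<Longrightarrow> par w w' \<Longrightarrow> eta_variant m r w'"
proof (induction arbitrary: w' rule: eta_variant.induct)
  case (ev_app m r w s t)
  have "\<not> (\<exists>T b. w = LAbs T b)" using ev_app.hyps(1) by (auto elim: ev_absE)
  then show ?case using ev_app by (auto elim!: par_appE intro: eta_variant.intros)
next
  case (ev_abs r w T U)
  consider (abs) V v where "w' = LAbs V v" "par w v"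
    | (eta) "par w (LApp (lift 0 w') (LBound 0))"
    using ev_abs.prems by (auto elim!: par_absE intro: par_app par_refl par_lift)
  then show ?case using ev_abs.IH by cases (auto intro: eta_variant.intros)
next
  case (ev_eta r w T)
  then show ?case by (meson eta_variant.ev_eta par_app par_lift par_refl)
qed (auto elim!: par_varE par_constE par_boundE intro: eta_variant.intros)

text \<open>The default 0 at an abstraction makes the counting equation below contradictory for an
  abstraction that is applied.\<close>

primrec head_arity :: "('v, 'c, 'b) lterm \<Rightarrow> nat" where
  "head_arity (LVar x) = arv x"
| "head_arity (LConst c) = arc c"
| "head_arity (LBound i) = 0"
| "head_arity (LApp s t) = head_arity s"
| "head_arity (LAbs T t) = 0"

lemma head_arity_lift [simp]: "head_arity (lift k t) = head_arity t"
  by (induction t arbitrary: k) auto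

text \<open>Every \<open>\<eta>\<close>-contraction trades a leading abstraction for one argument of the head, so the
  number of contractions can be read off the head's arity.\<close>

lemma eta_variant_count:
  "eta_variant m r w \<Longrightarrow> (0 < m \<longrightarrow> nlams r = 0) \<and>
     ((\<exists>T b. w = LAbs T b) \<and> m = 0 \<or> m + nargs w + nlams r = head_arity w)"
  by (induction rule: eta_variant.induct) auto

text \<open>The counting equation decides which rule ends both derivations; the remaining parts
  agree by induction.\<close>

lemma eta_variant_unique: "eta_variant m r w \<Longrightarrow> eta_variant m r' w \<Longrightarrow> erase r = erase r'"
proof (induction arbitrary: r' rule: eta_variant.induct)
  case (ev_var m x)
  from ev_var.prems ev_var.hyps show ?case
    by (cases rule: ev_varE) (auto dest!: eta_variant_count)
next
  case (ev_const m x)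
  from ev_const.prems ev_const.hyps show ?case
    by (cases rule: ev_constE) (auto dest!: eta_variant_count)
next
  case (ev_bound i)
  then show ?case by (cases rule: ev_boundE) (auto dest!: eta_variant_count)
next
  case (ev_app m r w s t)
  have c: "eta_variant m (LApp r s) (LApp w t)" using ev_app.hyps by (rule eta_variant.ev_app)
  consider (app) r1 s1 where "r' = LApp r1 s1" "eta_variant (Suc m) r1 w" "eta_variant 0 s1 t"
    | (eta) r1 T where "r' = LAbs T r1"
    using ev_app.prems by (cases rule: ev_appE) auto
  then show ?case
  proof cases
    case app
    then show ?thesis using ev_app.IH by simp
  next
    case eta
    \<comment> \<open>Having the same variant, both terms have equally many leading abstractions,
      but \<open>LApp r s\<close> has none and \<open>LAbs T r1\<close> at least one.\<close>
    then show ?thesis using eta_variant_count[OF c] eta_variant_count[OF ev_app.prems] by auto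
  qed
next
  case (ev_abs r w T U)
  \<comment> \<open>Had \<open>ev_eta\<close> been used, an abstraction would stand applied to
    \<open>LBound 0\<close>, and the count would equate a positive sum with head arity 0.\<close>
  from ev_abs.prems show ?case
    by (cases rule: ev_absE) (auto dest: ev_abs.IH eta_variant_count)
next
  case (ev_eta r w T)
  \<comment> \<open>By \<open>c\<close> the head of \<open>w\<close> lacks at least one argument, so
    the other derivation must end with \<open>ev_eta\<close> as well.\<close>
  note c = eta_variant_count[OF ev_eta.hyps]
  from ev_eta.prems show ?case
  proof (cases rule: eta_variant.cases)
    case (ev_app r1 w1 s1 t1)
    from c eta_variant_count[OF ev_app(3)] ev_app show ?thesis by auto
  qed (use c in \<open>auto dest: ev_eta.IH\<close>)
qed

lemma full_joinable_erase:
  assumes "full 0 s" "full 0 t" "joinable s t"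
  shows "erase s = erase t"
proof -
  have *: "eta_variant 0 r w" if "par\<^sup>*\<^sup>* r w" "full 0 r" for r w
    using that by (induction rule: rtranclp_induct) (auto intro: full_eta_variant eta_variant_par)
  from assms(3) obtain w where "par\<^sup>*\<^sup>* s w" "par\<^sup>*\<^sup>* t w" unfolding joinable_def by blast
  with * assms show ?thesis by (blast intro: eta_variant_unique)
qed

end

section \<open>Typing and substitution\<close>

primrec fv :: "('v, 'c, 'b) lterm \<Rightarrow> ('v, 'b) lvar set" where
  "fv (LVar x) = {x}"
| "fv (LConst c) = {}"
| "fv (LBound i) = {}"
| "fv (LApp s t) = fv s \<union> fv t"
| "fv (LAbs T t) = fv t"

lemma bind_var_fresh: "x \<notin> fv t \<Longrightarrow> bind_var k x t = lift k t"
  by (induction t arbitrary: k) auto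

lemma inst_bind_var: "inst k (LVar x) (bind_var k x t) = t"
  by (induction t arbitrary: k) auto

lemma bind_var_inject: "bind_var k x s = bind_var k x t \<longleftrightarrow> s = t"
  by (metis inst_bind_var)

lemma bind_var_lift: "i \<le> k \<Longrightarrow> bind_var (Suc k) x (lift i t) = lift i (bind_var k x t)"
  by (induction t arbitrary: i k) auto

lemma bind_var_inst:
  "i \<le> k \<Longrightarrow> bind_var k x (inst i u t) = inst i (bind_var k x u) (bind_var (Suc k) x t)"
  by (induction t arbitrary: i k u) (auto simp: bind_var_lift)

lemma fv_bind_var [simp]: "fv (bind_var k x t) = fv t - {x}"
  by (induction t arbitrary: k) auto

lemma fv_lam [simp]: "fv (lam x t) = fv t - {x}"
  by (simp add: lam_def)

lemma fv_lams [simp]: "fv (lams xs t) = fv t - set xs"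
  by (induction xs) (auto simp: lams_def)

lemma fv_apps [simp]: "fv (apps s ts) = fv s \<union> (\<Union>t \<in> set ts. fv t)"
  by (induction ts arbitrary: s) (auto simp: apps_def)

text \<open>\<open>full\<close> lets indices take no arguments, so exactly the variables of arity 0,
  such as the atoms, fit in their place.\<close>

lemma full_bind_var: "arv x = 0 \<Longrightarrow> full arv arc m (bind_var k x t) = full arv arc m t"
  by (induction t arbitrary: k m) auto

lemma full_lams:
  "(\<And>x. x \<in> set xs \<Longrightarrow> arv x = 0) \<Longrightarrow> full arv arc 0 t \<Longrightarrow> full arv arc 0 (lams xs t)"
  by (induction xs) (auto simp: lams_def lam_def full_bind_var)

lemma full_apps:
  "full arv arc m (apps s ts) \<longleftrightarrow> full arv arc (m + length ts) s \<and> (\<forall>t \<in> set ts. full arv arc 0 t)"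
  by (induction ts arbitrary: s) (auto simp: apps_def)

lemma erase_bind_var: "erase (bind_var k x t) = bind_var k x (erase t)"
  by (induction t arbitrary: k) auto

lemma erase_apps: "erase (apps s ts) = apps (erase s) (map erase ts)"
  by (induction ts arbitrary: s) (auto simp: apps_def)

lemma fv_erase [simp]: "fv (erase t) = fv t"
  by (induction t) auto

lemma erase_lams_inject: "erase (lams xs s) = erase (lams xs t) \<Longrightarrow> erase s = erase t"
  by (induction xs) (auto simp: lams_def lam_def erase_bind_var bind_var_inject)

lemma apps_inject:
  assumes "apps s ts = apps s' ts'" "\<And>u v. s \<noteq> LApp u v" "\<And>u v. s' \<noteq> LApp u v"
  shows "s = s' \<and> ts = ts'"
  using assms(1)
proof (induction ts arbitrary: ts' rule: rev_induct)
  case Nil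
  then show ?case using assms(2,3) by (cases ts' rule: rev_cases) (auto simp: apps_def)
next
  case (snoc t ts)
  show ?case
  proof (cases ts' rule: rev_cases)
    case Nil
    then show ?thesis using snoc.prems assms(3)[of "apps s ts" t] by (simp add: apps_def)
  next
    case ts': (snoc us u)
    then show ?thesis using snoc.IH[of us] snoc.prems by (simp add: apps_def)
  qed
qed

lemma apps_eq_nonapp:
  assumes "\<And>u v. t \<noteq> LApp u v"
  shows "apps s ts = t \<longleftrightarrow> s = t \<and> ts = []"
  using assms by (cases ts rule: rev_cases) (auto simp: apps_def)

lemma apps_eq_iffs:
  "apps (LConst c) ts = apps (LConst d) us \<longleftrightarrow> c = d \<and> ts = us"
  "apps (LVar x) ts = apps (LVar y) us \<longleftrightarrow> x = y \<and> ts = us"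
  "apps (LConst c) ts \<noteq> apps (LVar y) us" "apps (LVar y) us \<noteq> apps (LConst c) ts"
  "apps s ts = LVar x \<longleftrightarrow> s = LVar x \<and> ts = []" "LVar x = apps s ts \<longleftrightarrow> s = LVar x \<and> ts = []"
  "apps s ts = LAbs T t \<longleftrightarrow> s = LAbs T t \<and> ts = []" "LAbs T t = apps s ts \<longleftrightarrow> s = LAbs T t \<and> ts = []"
  by (auto dest: apps_inject simp: apps_eq_nonapp eq_commute[of _ "apps s ts"])

section \<open>Typing and equality under abstraction\<close>

lemma has_type_bind_var:
  "has_type C (\<Gamma> @ \<Delta>) t T \<Longrightarrow> has_type C (\<Gamma> @ snd x # \<Delta>) (bind_var (length \<Gamma>) x t) T"
proof (induction "\<Gamma> @ \<Delta>" t T arbitrary: \<Gamma> rule: has_type.induct)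
  case (1 y)
  then show ?case
    using has_type.intros(3)[of "length \<Gamma>" "\<Gamma> @ snd x # \<Delta>" C] has_type.intros(1)[of C _ y]
    by (cases "y = x") simp_all
next
  case (3 i)
  define j where "j = (if i < length \<Gamma> then i else Suc i)"
  have "j < length (\<Gamma> @ snd x # \<Delta>)" "(\<Gamma> @ snd x # \<Delta>) ! j = (\<Gamma> @ \<Delta>) ! i"
    using 3 by (auto simp: j_def nth_append Suc_diff_le)
  then show ?case using has_type.intros(3)[of j "\<Gamma> @ snd x # \<Delta>" C] by (simp add: j_def)
next
  case (5 T t U)
  from 5(2)[of "T # \<Gamma>"] show ?case by (auto intro: has_type.intros)
qed (auto intro: has_type.intros)

lemma has_type_lam: "has_type C [] t T \<Longrightarrow> has_type C [] (lam x t) (Arr (snd x) T)"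
  using has_type_bind_var[of C "[]" "[]" t T x] by (auto simp: lam_def intro: has_type.intros)

lemma has_type_lams: "has_type C [] t T \<Longrightarrow> has_type C [] (lams xs t) (arrs (map snd xs) T)"
  by (induction xs) (auto simp: lams_def arrs_def intro: has_type_lam)

lemma has_type_apps:
  "list_all2 (has_type C \<Gamma>) ts Ts \<Longrightarrow> has_type C \<Gamma> s (arrs Ts T) \<Longrightarrow> has_type C \<Gamma> (apps s ts) T"
  by (induction arbitrary: s rule: list_all2_induct)
    (auto simp: apps_def arrs_def intro: has_type.intros)

lemma has_type_lift_id: "has_type C \<Gamma> t T \<Longrightarrow> length \<Gamma> \<le> k \<Longrightarrow> lift k t = t"
  by (induction arbitrary: k rule: has_type.induct) auto

lemma beta_eta_eq_bind_var:
  "beta_eta_eq C (\<Gamma> @ \<Delta>) s t T \<Longrightarrow>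
    beta_eta_eq C (\<Gamma> @ snd x # \<Delta>) (bind_var (length \<Gamma>) x s) (bind_var (length \<Gamma>) x t) T"
proof (induction "\<Gamma> @ \<Delta>" s t T arbitrary: \<Gamma> rule: beta_eta_eq.induct)
  case (abs T t t' U)
  from abs(2)[of "T # \<Gamma>"] show ?case by (auto intro: beta_eta_eq.abs)
next
  case (beta T t U u)
  from has_type_bind_var[of C "T # \<Gamma>" \<Delta> t U x] has_type_bind_var[of C \<Gamma> \<Delta> u T x] beta
  show ?case by (auto simp: bind_var_inst intro!: beta_eta_eq.beta)
next
  case (eta t T U)
  then show ?case
    using has_type_bind_var[of C \<Gamma> \<Delta> t _ x] by (simp add: bind_var_lift beta_eta_eq.eta)
next
  case (trans s t T u)
  then show ?case by (blast intro: beta_eta_eq.trans)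
next
  case (sym s t T)
  then show ?case by (blast intro: beta_eta_eq.sym)
qed (auto intro: beta_eta_eq.refl beta_eta_eq.app has_type_bind_var)

lemma beta_eta_eq_lam:
  "beta_eta_eq C [] s t T \<Longrightarrow> beta_eta_eq C [] (lam x s) (lam x t) (Arr (snd x) T)"
  using beta_eta_eq_bind_var[of C "[]" "[]" s t T x]
  by (auto simp: lam_def intro: beta_eta_eq.abs)

lemma beta_eta_eq_lams:
  "beta_eta_eq C [] s t T \<Longrightarrow> beta_eta_eq C [] (lams xs s) (lams xs t) (arrs (map snd xs) T)"
  by (induction xs) (auto simp: lams_def arrs_def intro: beta_eta_eq_lam)

lemma beta_eta_eq_apps:
  "list_all2 (\<lambda>t. beta_eta_eq C \<Gamma> (g t) (h t)) ts Ts \<Longrightarrow> beta_eta_eq C \<Gamma> s s' (arrs Ts T) \<Longrightarrow>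
    beta_eta_eq C \<Gamma> (apps s (map g ts)) (apps s' (map h ts)) T"
  by (induction arbitrary: s s' rule: list_all2_induct)
    (auto simp: apps_def arrs_def intro: beta_eta_eq.app)

section \<open>Substitutions and renamings\<close>

lemma lsubst_app_apps: "lsubst_app \<theta> (apps s ts) = apps (lsubst_app \<theta> s) (map (lsubst_app \<theta>) ts)"
  by (induction ts arbitrary: s) (auto simp: apps_def)

text \<open>The substituted terms are closed by their typing and do not mention \<open>x\<close>, so
  neither lifting them under a binder nor binding \<open>x\<close> changes them.\<close>

lemma lsubst_app_lam:
  assumes "\<And>y u. \<theta> y = Some u \<Longrightarrow> has_type C [] u (snd y)"
    and "\<And>y u. \<theta> y = Some u \<Longrightarrow> x \<notin> fv u" and "\<theta> x = None"
  shows "lsubst_app \<theta> (lam x s) = lam x (lsubst_app \<theta> s)"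
proof -
  have lift: "(\<lambda>x. map_option (lift 0) (\<theta> x)) = \<theta>"
  proof
    fix y show "map_option (lift 0) (\<theta> y) = \<theta> y"
      using assms(1) has_type_lift_id by (cases "\<theta> y") fastforce+
  qed
  have "bind_var k x u = u" if "\<theta> y = Some u" for k y u
    using assms(1,2)[OF that] has_type_lift_id by (fastforce simp: bind_var_fresh)
  then have "lsubst_app \<theta> (bind_var k x s) = bind_var k x (lsubst_app \<theta> s)" for k
    using assms(3) lift by (induction s arbitrary: k) (auto split: option.splits)
  then show ?thesis by (simp add: lam_def lift)
qed

lemma lsubst_app_lams:
  assumes "\<And>y u. \<theta> y = Some u \<Longrightarrow> has_type C [] u (snd y)"
    and "\<And>y u. \<theta> y = Some u \<Longrightarrow> set xs \<inter> fv u = {}" and "\<And>x. x \<in> set xs \<Longrightarrow> \<theta> x = None"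
  shows "lsubst_app \<theta> (lams xs s) = lams xs (lsubst_app \<theta> s)"
  using assms(2,3)
proof (induction xs)
  case (Cons x xs)
  have "lsubst_app \<theta> (lam x (lams xs s)) = lam x (lsubst_app \<theta> (lams xs s))"
    using Cons.prems by (intro lsubst_app_lam[where C = C] assms(1)) auto
  then show ?case using Cons by (auto simp: lams_def)
qed (simp add: lams_def)

abbreviation ren :: "(('v, 'b) lvar \<Rightarrow> ('v, 'b) lvar) \<Rightarrow> ('v, 'c, 'b) lterm \<Rightarrow> ('v, 'c, 'b) lterm" where
  "ren g \<equiv> lsubst_app (\<lambda>x. Some (LVar (g x)))"

lemma ren_cong: "(\<And>x. x \<in> fv s \<Longrightarrow> g x = h x) \<Longrightarrow> ren g s = ren h s"
  by (induction s) auto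

lemma ren_id [simp]: "ren (\<lambda>x. x) s = s"
  by (induction s) auto

lemma ren_ren: "ren g (ren h s) = ren (\<lambda>x. g (h x)) s"
  by (induction s) auto

lemma ren_bind_var: "inj g \<Longrightarrow> ren g (bind_var k x s) = bind_var k (g x) (ren g s)"
  by (induction s arbitrary: k) (auto simp: inj_eq)

lemma erase_ren: "erase (ren g s) = ren g (erase s)"
  by (induction s) auto

text \<open>Once bound, \<open>x\<close> is an index that \<open>g\<close> cannot touch, so a
  \<beta>-step with a variable as argument merely overrides \<open>g\<close> at
  \<open>x\<close>.\<close>

lemma inst_ren_bind_var: "inst k (LVar v) (ren g (bind_var k x s)) = ren (g(x := v)) s"
  by (induction s arbitrary: k) auto

lemma has_type_ren:
  "has_type C \<Gamma> s T \<Longrightarrow> (\<And>x. snd (g x) = snd x) \<Longrightarrow> has_type C \<Gamma> (ren g s) T"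
proof (induction rule: has_type.induct)
  case (1 \<Gamma> x)
  then show ?case using has_type.intros(1)[of C \<Gamma> "g x"] by simp
qed (auto intro: has_type.intros)

text \<open>The abstractions are contracted from the outside in. The accumulator \<open>g\<close>
  records the replacements already made, so that the iteration amounts to one simultaneous
  renaming.\<close>

lemma apps_lams_beta:
  assumes "has_type C [] s T" "\<And>x. snd (f x) = snd x" "\<And>x. snd (g x) = snd x"
  shows "beta_eta_eq C [] (apps (ren g (lams xs s)) (map (\<lambda>x. LVar (f x)) xs))
    (ren (\<lambda>x. if x \<in> set xs then f x else g x) s) T"
  using assms(3)
proof (induction xs arbitrary: g)
  case Nil
  then show ?case by (simp add: apps_def lams_def beta_eta_eq.refl has_type_ren[OF assms(1)])
next
  case (Cons x xs)
  have v: "has_type C \<Gamma> (LVar (f y)) (snd y)" for y \<Gamma>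
    using has_type.intros(1)[of C \<Gamma> "f y"] assms(2) by simp
  let ?b = "ren g (bind_var 0 x (lams xs s))"
  have "has_type C [snd x] (bind_var 0 x (lams xs s)) (arrs (map snd xs) T)"
    using has_type_bind_var[of C "[]" "[]", OF _] has_type_lams[OF assms(1)] by fastforce
  then have "has_type C [snd x] ?b (arrs (map snd xs) T)" using Cons.prems by (rule has_type_ren)
  from beta_eta_eq.beta[OF this v]
  have "beta_eta_eq C [] (LApp (ren g (lam x (lams xs s))) (LVar (f x)))
      (ren (g(x := f x)) (lams xs s)) (arrs (map snd xs) T)"
    by (simp add: lam_def inst_ren_bind_var)
  then have 1: "beta_eta_eq C []
      (apps (LApp (ren g (lam x (lams xs s))) (LVar (f x))) (map (\<lambda>x. LVar (f x)) xs))
      (apps (ren (g(x := f x)) (lams xs s)) (map (\<lambda>x. LVar (f x)) xs)) T"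
    by (rule beta_eta_eq_apps[rotated])
      (auto simp: list_all2_map2 list_all2_same intro: v beta_eta_eq.refl)
  have 2: "beta_eta_eq C []
      (apps (ren (g(x := f x)) (lams xs s)) (map (\<lambda>x. LVar (f x)) xs))
      (ren (\<lambda>y. if y \<in> set xs then f y else (g(x := f x)) y) s) T"
    using Cons.prems assms(2) by (intro Cons.IH) auto
  \<comment> \<open>A later occurrence of \<open>x\<close> in \<open>xs\<close> is also sent to
    \<open>f x\<close>, so both ways of overriding agree.\<close>
  have eq: "(if y \<in> set xs then f y else (g(x := f x)) y) = (if y \<in> set (x # xs) then f y else g y)"
    for y by auto
  from beta_eta_eq.trans[OF 1 2[unfolded eq]] show ?case by (simp add: lams_def apps_def)
qed

section \<open>The translation\<close>

lemma perm_atom_Nil [simp]: "perm_atom [] a = a"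
  by (simp add: perm_atom_def)

lemma perm_atom_Cons [simp]: "perm_atom ((a, b) # p) c = transpose a b (perm_atom p c)"
  by (simp add: perm_atom_def)

lemma perm_atom_append: "perm_atom (p @ q) c = perm_atom p (perm_atom q c)"
  by (simp add: perm_atom_def)

lemma perm_term_Nil [simp]: "perm_term [] t = t"
  by (simp add: perm_term_def)

lemma perm_term_Cons [simp]: "perm_term ((a, b) # p) t = swap_term a b (perm_term p t)"
  by (simp add: perm_term_def)

lemma perm_atom_rev [simp]: "perm_atom (rev p) (perm_atom p c) = c"
  by (induction p) (auto simp: perm_atom_append)

lemma perm_atom_rev' [simp]: "perm_atom p (perm_atom (rev p) c) = c"
  using perm_atom_rev[of "rev p"] by simp

lemma sorted_perm_Cons [simp]:
  "sorted_perm S ((a, b) # p) \<longleftrightarrow> atom_sort S a = atom_sort S b \<and> sorted_perm S p"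
  by (simp add: sorted_perm_def)

lemma atom_sort_transpose:
  "atom_sort S a = atom_sort S b \<Longrightarrow> atom_sort S (transpose a b c) = atom_sort S c"
  by (auto simp: transpose_def)

lemma atom_sort_perm_atom: "sorted_perm S p \<Longrightarrow> atom_sort S (perm_atom p c) = atom_sort S c"
  by (induction p) (auto simp: atom_sort_transpose)

text \<open>Replaces the generated rule, which uses the set functions of pairs;
  \<open>nterm.set\<close> is deleted from the simp set wherever this one is used.\<close>

lemma nt_atoms_Susp: "nt_atoms (Susp p X) = fst ` set p \<union> snd ` set p"
  by (force simp: prod_set_defs)

lemma perm_atom_in:
  "fst ` set p \<union> snd ` set p \<subseteq> A \<Longrightarrow> c \<in> A \<Longrightarrow> perm_atom p c \<in> A"
  by (induction p) (auto simp: transpose_def)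

lemma perm_atom_outside: "c \<notin> fst ` set p \<union> snd ` set p \<Longrightarrow> perm_atom p c = c"
  by (induction p) (auto simp: transpose_def)

lemma nt_atoms_swap_term: "nt_atoms (swap_term a b t) \<subseteq> insert a (insert b (nt_atoms t))"
proof (induction t)
  case (Susp p X)
  then show ?case by (simp del: nterm.set add: nt_atoms_Susp) blast
qed (auto simp: transpose_def)

lemma nt_atoms_perm_term: "nt_atoms (perm_term p t) \<subseteq> fst ` set p \<union> snd ` set p \<union> nt_atoms t"
proof (induction p)
  case (Cons ab p)
  obtain a b where "ab = (a, b)" by fastforce
  then show ?case using Cons nt_atoms_swap_term[of a b "perm_term p t"] by auto
qed simp

lemma nt_atoms_nsubst_app: "nt_atoms (nsubst_app \<sigma> t) \<subseteq> nt_atoms t \<union> subst_atoms \<sigma>"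
proof (induction t)
  case (Susp p X)
  show ?case
  proof (cases "\<sigma> X")
    case (Some t)
    then have "nt_atoms t \<subseteq> subst_atoms \<sigma>" by (auto simp: subst_atoms_def ran_def)
    then show ?thesis using nt_atoms_perm_term[of p t] Some
      by (simp del: nterm.set add: nt_atoms_Susp) blast
  qed simp
qed auto

lemma has_sort_swap_term:
  "has_sort S t \<tau> \<Longrightarrow> atom_sort S a = atom_sort S b \<Longrightarrow> has_sort S (swap_term a b t) \<tau>"
proof (induction rule: has_sort.induct)
  case (1 f \<tau>s \<tau> ts)
  then show ?case by (auto simp: list_all2_map1 intro!: has_sort.intros elim!: list_all2_mono)
next
  case (2 c)
  then show ?case using has_sort.intros(2)[of S "transpose a b c"] by (simp add: atom_sort_transpose)
next
  case (3 t \<tau> c)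
  then show ?case using has_sort.intros(3)[of S _ \<tau> "transpose a b c"]
    by (simp add: atom_sort_transpose)
qed (auto intro: has_sort.intros)

lemma has_sort_perm_term: "has_sort S t \<tau> \<Longrightarrow> sorted_perm S p \<Longrightarrow> has_sort S (perm_term p t) \<tau>"
  by (induction p) (auto intro: has_sort_swap_term)

lemma has_sort_nsubst_app:
  "has_sort S t \<tau> \<Longrightarrow> nominal_subst S \<sigma> \<Longrightarrow> has_sort S (nsubst_app \<sigma> t) \<tau>"
proof (induction rule: has_sort.induct)
  case (1 f \<tau>s \<tau> ts)
  then show ?case by (auto simp: list_all2_map1 intro!: has_sort.intros elim!: list_all2_mono)
qed (auto simp: nominal_subst_def split: option.splits intro: has_sort.intros has_sort_perm_term)

section \<open>Renaming the variables of atoms\<close>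

lemma snd_atom_var [simp]: "snd (atom_var S a) = Base (Inl (atom_sort S a))"
  by (simp add: atom_var_def)

lemma atom_var_inject [simp]: "atom_var S a = atom_var S b \<longleftrightarrow> a = b"
  by (auto simp: atom_var_def)

lemma atom_var_neq_unk_var [simp]:
  "atom_var S a \<noteq> unk_var S bs X" "unk_var S bs X \<noteq> atom_var S a"
  by (auto simp: atom_var_def unk_var_def)

text \<open>A variable with the name of an atom but another type is fixed. Thus an injective
  \<open>g\<close> gives an injective renaming, and a sort-preserving \<open>g\<close> a
  type-preserving one.\<close>

definition atom_ren :: "('a, 'x, 'f, 'n, 'd) nsignature \<Rightarrow> ('a \<Rightarrow> 'a) \<Rightarrow>
    ('a + 'x, 'n + 'd) lvar \<Rightarrow> ('a + 'x, 'n + 'd) lvar" where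
  "atom_ren S g x = (case fst x of
     Inl a \<Rightarrow> if x = atom_var S a then atom_var S (g a) else x | Inr X \<Rightarrow> x)"

lemma atom_ren_atom_var [simp]: "atom_ren S g (atom_var S a) = atom_var S (g a)"
  by (simp add: atom_ren_def atom_var_def)

lemma atom_ren_Inr [simp]: "fst x = Inr X \<Longrightarrow> atom_ren S g x = x"
  by (simp add: atom_ren_def)

lemma fst_unk_var [simp]: "fst (unk_var S bs X) = Inr X"
  by (simp add: unk_var_def)

lemma atom_ren_cases:
  obtains a where "x = atom_var S a" | "\<And>g. atom_ren S g x = x" "x \<notin> range (atom_var S)"
proof (cases "x \<in> range (atom_var S)")
  case False
  then have "atom_ren S g x = x" for g by (auto simp: atom_ren_def split: sum.splits)
  then show ?thesis using that False by blast
qed (use that in blast)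

lemma inj_atom_ren: "inj g \<Longrightarrow> inj (atom_ren S g)"
proof (rule injI)
  fix x y assume "inj g" "atom_ren S g x = atom_ren S g y"
  then show "x = y"
    by (cases x rule: atom_ren_cases[where S = S]; cases y rule: atom_ren_cases[where S = S])
      (auto simp: inj_eq)
qed

lemma snd_atom_ren: "(\<And>a. atom_sort S (g a) = atom_sort S a) \<Longrightarrow> snd (atom_ren S g x) = snd x"
  by (cases x rule: atom_ren_cases[where S = S]) auto

text \<open>At a suspension the new swapping acts on the arguments only, the unknown being fixed. At
  a binder the equal sorts keep its type, and injectivity avoids capture.\<close>

lemma tr_term_swap_term:
  assumes "atom_sort S a = atom_sort S b"
  shows "tr_term S as nabla (swap_term a b t) = ren (atom_ren S (transpose a b)) (tr_term S as nabla t)"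
proof (induction t)
  case (Abst c t)
  have "inj (atom_ren S (transpose a b))" by (intro inj_atom_ren inj_transpose)
  from ren_bind_var[OF this, of 0 "atom_var S c" "tr_term S as nabla t"] Abst assms show ?case
    by (simp add: lam_def atom_sort_transpose)
qed (auto simp: lsubst_app_apps Let_def comp_def cong: map_cong)

lemma tr_term_perm_term:
  "sorted_perm S p \<Longrightarrow>
    tr_term S as nabla (perm_term p t) = ren (atom_ren S (perm_atom p)) (tr_term S as nabla t)"
proof (induction p)
  case Nil
  have "atom_ren S (\<lambda>a. a) = (\<lambda>x. x)"
    by (rule ext, case_tac x rule: atom_ren_cases[where S = S]) auto
  then show ?case by simp
next
  case (Cons ab p)
  have "atom_ren S (transpose a b) (atom_ren S (perm_atom p) x)
      = atom_ren S (\<lambda>c. transpose a b (perm_atom p c)) x"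
    for a b x by (cases x rule: atom_ren_cases[where S = S]) auto
  then show ?case using Cons by (cases ab) (simp add: tr_term_swap_term ren_ren)
qed

section \<open>Freshness and typing of translated terms\<close>

lemma fv_tr_term:
  "nt_atoms t \<subseteq> set as \<Longrightarrow>
    fv (tr_term S as nabla t) \<subseteq> atom_var S ` set as \<union> {x. \<exists>X. fst x = Inr X}"
proof (induction t)
  case (Susp p X)
  then show ?case
    by (auto simp del: nterm.set simp: nt_atoms_Susp Let_def intro!: imageI perm_atom_in)
next
  case (Fn f ts)
  then show ?case by (simp add: UN_subset_iff)
next
  case (Abst a t)
  then show ?case by auto
qed simp

lemma fresh_fv_tr_term: "fresh nabla a t \<Longrightarrow> atom_var S a \<notin> fv (tr_term S as nabla t)"
  by (induction rule: fresh.induct) (auto simp: Let_def)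

text \<open>At a suspension, \<open>a\<close> is an argument iff its preimage under \<open>p\<close>
  is listed in \<open>as\<close> and not constrained. The preimage is listed, so absence of
  \<open>a\<close> yields the constraint.\<close>

lemma fv_tr_term_fresh:
  "atom_var S a \<notin> fv (tr_term S as nabla t) \<Longrightarrow> nt_atoms t \<subseteq> set as \<Longrightarrow> a \<in> set as \<Longrightarrow>
    fresh nabla a t"
proof (induction t)
  case (Susp p X)
  have "perm_atom (rev p) a \<in> set as"
    using Susp by (intro perm_atom_in) (auto simp del: nterm.set simp: nt_atoms_Susp)
  then have "(perm_atom (rev p) a, X) \<in> nabla"
    using Susp(1) by (auto simp: Let_def)
  then show ?case by (rule fresh.intros)
next
  case (Abst c t)
  then show ?case by (cases "a = c") (auto intro: fresh.intros)
next
  case (Fn f ts)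
  then show ?case by (auto intro!: fresh.intros)
qed (auto intro: fresh.intros)

lemma has_type_tr_term:
  "has_sort S t \<tau> \<Longrightarrow> has_type (tr_const_type S) [] (tr_term S as nabla t) (tr_sort \<tau>)"
proof (induction rule: has_sort.induct)
  case (1 f \<tau>s \<tau> ts)
  have "has_type (tr_const_type S) [] (LConst f) (arrs (map tr_sort \<tau>s) (tr_sort \<tau>))"
    using has_type.intros(2)[of "tr_const_type S" "[]" f] 1 by (simp add: tr_const_type_def)
  then show ?case using 1
    by (auto simp: list_all2_map1 list_all2_map2 intro!: has_type_apps elim!: list_all2_mono)
next
  case (2 a)
  then show ?case using has_type.intros(1)[of _ _ "atom_var S a"] by simp
next
  case (3 t \<tau> a)
  then show ?case using has_type_lam[of _ _ _ "atom_var S a"] by simp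
next
  case (4 p X)
  let ?bs = "filter (\<lambda>a. (a, X) \<notin> nabla) as"
  have "has_type (tr_const_type S) [] (LVar (unk_var S ?bs X))
     (arrs (map (\<lambda>b. tr_sort (AtomSort (atom_sort S b))) ?bs) (tr_sort (var_sort S X)))"
    using has_type.intros(1)[of _ _ "unk_var S ?bs X"] by (simp add: unk_var_def)
  moreover have "has_type (tr_const_type S) [] (LVar (atom_var S (perm_atom p b)))
      (Base (Inl (atom_sort S b)))" for b
    using has_type.intros(1)[of _ _ "atom_var S (perm_atom p b)"] 4
    by (simp add: atom_sort_perm_atom)
  ultimately show ?case
    by (auto simp: Let_def list_all2_map1 list_all2_map2 list_all2_same intro!: has_type_apps)
qed

section \<open>Nominal equality and \<alpha>-equality\<close>

inductive_cases has_sort_FnE: "has_sort S (Fn f ts) \<tau>"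
inductive_cases has_sort_AbstE: "has_sort S (Abst a t) \<tau>"

text \<open>Atoms on which two permutations of \<open>X\<close> disagree are fresh for
  \<open>X\<close>, hence missing from its argument list. The common sort makes the types of two
  binders coincide.\<close>

lemma nom_eq_tr_term:
  "nom_eq nabla t u \<Longrightarrow> has_sort S t \<tau> \<Longrightarrow> has_sort S u \<tau> \<Longrightarrow>
    tr_term S as nabla t = tr_term S as nabla u"
proof (induction arbitrary: \<tau> rule: nom_eq.induct)
  case (2 p p' X)
  then show ?case by (auto simp: Let_def intro!: arg_cong[where f = "apps _"])
next
  case (3 ts ts' f)
  from 3(2,3) obtain \<tau>s where "list_all2 (has_sort S) ts \<tau>s" "list_all2 (has_sort S) ts' \<tau>s"
    by (auto elim!: has_sort_FnE)
  then have "map (tr_term S as nabla) ts = map (tr_term S as nabla) ts'"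
    using 3(1) by (auto simp: list_all2_conv_all_nth intro!: nth_equalityI)
  then show ?case by simp
next
  case (4 t t' a)
  then show ?case by (auto elim!: has_sort_AbstE)
next
  case (5 a a' t t')
  then obtain \<tau>' where \<tau>': "has_sort S t \<tau>'" "has_sort S t' \<tau>'" and sort: "atom_sort S a = atom_sort S a'"
    by (auto elim!: has_sort_AbstE)
  let ?g = "atom_ren S (transpose a a')" and ?r' = "tr_term S as nabla t'"
  have inj: "inj ?g" by (intro inj_atom_ren inj_transpose)
  have "tr_term S as nabla t = ren ?g ?r'"
    using "5.IH"[OF \<tau>'(1) has_sort_swap_term[OF \<tau>'(2) sort]] tr_term_swap_term[OF sort] by metis
  then have "bind_var 0 (atom_var S a) (tr_term S as nabla t) = ren ?g (bind_var 0 (atom_var S a') ?r')"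
    using ren_bind_var[OF inj, of 0 "atom_var S a'" ?r'] by simp
  \<comment> \<open>The transposition moves only \<open>a\<close> and \<open>a'\<close>: the former
    is not free by freshness, the latter has been bound.\<close>
  also have "\<dots> = ren (\<lambda>x. x) (bind_var 0 (atom_var S a') ?r')"
  proof (rule ren_cong)
    fix x assume x: "x \<in> fv (bind_var 0 (atom_var S a') ?r')"
    show "?g x = x"
      using x fresh_fv_tr_term[OF \<open>fresh nabla a t'\<close>]
      by (cases x rule: atom_ren_cases[where S = S]) (auto simp: transpose_def)
  qed
  finally show ?case using sort by (simp add: lam_def)
qed auto

text \<open>The head determines the outermost constructor, and the arguments of an unknown show the
  permutation on all listed atoms not declared fresh. The common sort supplies the binder types lost
  by \<open>erase\<close>.\<close>

lemma erase_tr_term_nom_eq: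
  assumes "erase (tr_term S as nabla t) = erase (tr_term S as nabla u)"
    and "has_sort S t \<tau>" "has_sort S u \<tau>" "nt_atoms t \<subseteq> set as" "nt_atoms u \<subseteq> set as"
  shows "nom_eq nabla t u"
  using assms
proof (induction t arbitrary: u \<tau>)
  case (Fn f ts)
  then obtain us where u: "u = Fn f us"
    and eq: "map (\<lambda>t. erase (tr_term S as nabla t)) ts = map (\<lambda>t. erase (tr_term S as nabla t)) us"
    by (cases u) (auto simp: erase_apps lam_def Let_def comp_def apps_eq_iffs)
  obtain \<tau>s where sorts: "list_all2 (has_sort S) ts \<tau>s" "list_all2 (has_sort S) us \<tau>s"
    using Fn.prems(2,3) u by (auto elim!: has_sort_FnE)
  have "nom_eq nabla (ts ! i) (us ! i)" if i: "i < length ts" for i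
  proof (rule Fn.IH)
    have "length us = length ts" using eq map_eq_imp_length_eq by metis
    with i show "ts ! i \<in> set ts" "nt_atoms (ts ! i) \<subseteq> set as" "nt_atoms (us ! i) \<subseteq> set as"
      using Fn.prems(4,5) u by (auto simp: UN_subset_iff)
    show "erase (tr_term S as nabla (ts ! i)) = erase (tr_term S as nabla (us ! i))"
      using arg_cong[OF eq, of "\<lambda>l. l ! i"] i \<open>length us = length ts\<close> by simp
    show "has_sort S (ts ! i) (\<tau>s ! i)" "has_sort S (us ! i) (\<tau>s ! i)"
      using sorts i \<open>length us = length ts\<close> by (auto simp: list_all2_conv_all_nth)
  qed
  then have "list_all2 (nom_eq nabla) ts us"
    using eq map_eq_imp_length_eq by (fastforce simp: list_all2_conv_all_nth)
  then show ?case using u by (auto intro: nom_eq.intros)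
next
  case (Atm a)
  then have "u = Atm a" by (cases u) (auto simp: erase_apps lam_def Let_def apps_eq_iffs)
  then show ?case by (auto intro: nom_eq.intros)
next
  case (Abst a t)
  let ?r = "erase (tr_term S as nabla t)"
  obtain a' t' where u: "u = Abst a' t'"
    and eq: "bind_var 0 (atom_var S a) ?r
      = bind_var 0 (atom_var S a') (erase (tr_term S as nabla t'))"
    using Abst.prems(1) by (cases u) (auto simp: erase_apps erase_bind_var lam_def Let_def apps_eq_iffs)
  let ?r' = "erase (tr_term S as nabla t')"
  obtain \<tau>' where \<tau>': "has_sort S t \<tau>'" "has_sort S t' \<tau>'"
    and sort: "atom_sort S a = atom_sort S a'"
    using Abst.prems(2,3) u by (auto elim!: has_sort_AbstE)
  have atoms: "nt_atoms t \<subseteq> set as" "nt_atoms t' \<subseteq> set as" "a \<in> set as" "a' \<in> set as"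
    using Abst.prems(4,5) u by auto
  show ?case
  proof (cases "a = a'")
    case True
    then have "nom_eq nabla t t'" using eq Abst.IH \<tau>' atoms by (auto simp: bind_var_inject)
    then show ?thesis using u True by (auto intro: nom_eq.intros)
  next
    case False
    \<comment> \<open>Being bound on the left-hand side of \<open>eq\<close>, \<open>a\<close> is
      not free on the right-hand side.\<close>
    have "atom_var S a \<notin> fv (bind_var 0 (atom_var S a') ?r')" unfolding eq[symmetric] by simp
    then have nin: "atom_var S a \<notin> fv (tr_term S as nabla t')" using False by simp
    have "?r = inst 0 (LVar (atom_var S a)) (ren (\<lambda>x. x) (bind_var 0 (atom_var S a') ?r'))"
      using arg_cong[OF eq, of "inst 0 (LVar (atom_var S a))"] by (simp add: inst_bind_var)
    also have "\<dots> = ren ((\<lambda>x. x)(atom_var S a' := atom_var S a)) ?r'"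
      by (rule inst_ren_bind_var)
    \<comment> \<open>As \<open>a\<close> is not free in \<open>?r'\<close>, sending
      \<open>a'\<close> to \<open>a\<close> acts on it like the transposition.\<close>
    also have "\<dots> = ren (atom_ren S (transpose a a')) ?r'"
    proof (rule ren_cong)
      fix x assume x: "x \<in> fv ?r'"
      show "((\<lambda>x. x)(atom_var S a' := atom_var S a)) x = atom_ren S (transpose a a') x"
        using x nin by (cases x rule: atom_ren_cases[where S = S]) (auto simp: transpose_def)
    qed
    also have "\<dots> = erase (tr_term S as nabla (swap_term a a' t'))"
      by (simp add: tr_term_swap_term[OF sort] erase_ren)
    finally have "nom_eq nabla t (swap_term a a' t')"
      using \<tau>' atoms nt_atoms_swap_term[of a a' t'] by (intro Abst.IH has_sort_swap_term sort) auto
    moreover have "fresh nabla a t'" using nin atoms by (intro fv_tr_term_fresh)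
    ultimately show ?thesis unfolding u by (rule nom_eq.intros(5)[OF False])
  qed
next
  case (Susp p X)
  let ?bs = "filter (\<lambda>a. (a, X) \<notin> nabla) as"
  obtain q where u: "u = Susp q X"
    and eq: "map (\<lambda>b. perm_atom p b) ?bs = map (\<lambda>b. perm_atom q b) ?bs"
    using Susp.prems(1) by (cases u) (auto simp: erase_apps lam_def Let_def apps_eq_iffs unk_var_def atom_var_def)
  \<comment> \<open>On \<open>as\<close> the equation \<open>eq\<close> decides; an atom outside
    occurs in neither permutation and is fixed by both.\<close>
  have "(a, X) \<in> nabla" if "perm_atom p a \<noteq> perm_atom q a" for a
  proof (rule ccontr)
    assume "(a, X) \<notin> nabla"
    with eq that have "a \<notin> set as" by auto
    then have "perm_atom p a = a" "perm_atom q a = a"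
      using Susp.prems(4,5) u
      by (auto simp del: nterm.set simp: nt_atoms_Susp intro!: perm_atom_outside)
    with that show False by simp
  qed
  then show ?case using u by (auto intro: nom_eq.intros)
qed

text \<open>The arity of an unknown can be read off its name, since all occurrences of
  \<open>X\<close> keep the same atoms as arguments. Atoms have base types, hence arity 0.\<close>

lemma full_tr_term:
  "has_sort S t \<tau> \<Longrightarrow>
    full (\<lambda>x. case fst x of Inl a \<Rightarrow> 0 | Inr X \<Rightarrow> length (filter (\<lambda>a. (a, X) \<notin> nabla) as))
      (\<lambda>f. length (fst (fun_arity S f))) 0 (tr_term S as nabla t)"
proof (induction rule: has_sort.induct)
  case (1 f \<tau>s \<tau> ts)
  then show ?case by (auto simp: full_apps list_all2_conv_all_nth in_set_conv_nth)
qed (auto simp: full_apps lam_def full_bind_var Let_def atom_var_def unk_var_def)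

section \<open>The translated substitution and single equations\<close>

context
  fixes S :: "('a, 'x, 'f, 'n, 'd) nsignature"
    and as :: "'a list"
    and nabla :: "('a \<times> 'x) set"
    and \<sigma> :: "('a, 'x, 'f) nsubst"
  assumes \<sigma>: "nominal_subst S \<sigma>" and \<sigma>_atoms: "subst_atoms \<sigma> \<subseteq> set as"
begin

lemma tr_subst_SomeE:
  assumes "tr_subst S as nabla \<sigma> y = Some u"
  obtains X t where "y = unk_var S as X" "\<sigma> X = Some t" "u = tr_closed S as nabla t"
  using assms by (auto simp: tr_subst_def split: sum.splits if_splits)

lemma tr_subst_atom_var [simp]: "tr_subst S as nabla \<sigma> (atom_var S a) = None"
  by (simp add: tr_subst_def atom_var_def)

lemma has_type_tr_closed:
  assumes "has_sort S t \<tau>"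
  shows "has_type (tr_const_type S) [] (tr_closed S as nabla t)
    (arrs (map (\<lambda>a. Base (Inl (atom_sort S a))) as) (tr_sort \<tau>))"
  using has_type_lams[OF has_type_tr_term[OF assms], of "map (atom_var S) as"]
  by (simp add: tr_closed_def comp_def)

lemma tr_subst_has_type:
  "tr_subst S as nabla \<sigma> y = Some u \<Longrightarrow> has_type (tr_const_type S) [] u (snd y)"
  using \<sigma> by (auto elim!: tr_subst_SomeE simp: nominal_subst_def unk_var_def intro!: has_type_tr_closed)

text \<open>The closing abstractions bind all atoms of \<open>as\<close>, hence all those of
  \<sigma>; thus substitution under a binder captures nothing.\<close>

lemma atom_var_notin_tr_subst: "tr_subst S as nabla \<sigma> y = Some u \<Longrightarrow> atom_var S a \<notin> fv u"
proof (erule tr_subst_SomeE)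
  fix X t assume *: "\<sigma> X = Some t" "u = tr_closed S as nabla t"
  then have "nt_atoms t \<subseteq> set as" using \<sigma>_atoms by (auto simp: subst_atoms_def ran_def)
  from fv_tr_term[OF this, of S nabla] show "atom_var S a \<notin> fv u"
    using * by (auto simp: tr_closed_def atom_var_def)
qed

text \<open>In the empty environment an unknown takes all of \<open>as\<close> as arguments, so it
  is the variable that \<open>tr_subst\<close> replaces. Contracting the closing abstractions
  against the permuted atoms then performs the permutation as a renaming.\<close>

lemma tr_subst_tr_term:
  assumes "has_sort S t \<tau>" "nt_vars t \<subseteq> dom \<sigma>"
  shows "beta_eta_eq (tr_const_type S) [] (lsubst_app (tr_subst S as nabla \<sigma>) (tr_term S as {} t))
    (tr_term S as nabla (nsubst_app \<sigma> t)) (tr_sort \<tau>)"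
  using assms
proof (induction rule: has_sort.induct)
  case (1 f \<tau>s \<tau> ts)
  let ?C = "tr_const_type S"
  have "has_type ?C [] (LConst f) (arrs (map tr_sort \<tau>s) (tr_sort \<tau>))"
    using has_type.intros(2)[of ?C "[]" f] 1 by (simp add: tr_const_type_def)
  moreover have "list_all2 (\<lambda>t. beta_eta_eq ?C [] (lsubst_app (tr_subst S as nabla \<sigma>) (tr_term S as {} t))
    (tr_term S as nabla (nsubst_app \<sigma> t))) ts (map tr_sort \<tau>s)"
    using 1 by (auto simp: list_all2_conv_all_nth UN_subset_iff)
  ultimately have "beta_eta_eq ?C []
      (apps (LConst f) (map (\<lambda>t. lsubst_app (tr_subst S as nabla \<sigma>) (tr_term S as {} t)) ts))
      (apps (LConst f) (map (\<lambda>t. tr_term S as nabla (nsubst_app \<sigma> t)) ts)) (tr_sort \<tau>)"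
    by (intro beta_eta_eq_apps beta_eta_eq.refl)
  then show ?case by (simp add: lsubst_app_apps comp_def)
next
  case (2 a)
  then show ?case
    using has_type_tr_term[OF has_sort.intros(2)[of S a]] by (auto intro: beta_eta_eq.refl)
next
  case (3 t \<tau> a)
  have "lsubst_app (tr_subst S as nabla \<sigma>) (lam (atom_var S a) (tr_term S as {} t))
      = lam (atom_var S a) (lsubst_app (tr_subst S as nabla \<sigma>) (tr_term S as {} t))"
    by (intro lsubst_app_lam[where C = "tr_const_type S"] tr_subst_has_type atom_var_notin_tr_subst tr_subst_atom_var)
  with 3 beta_eta_eq_lam[of _ _ _ _ "atom_var S a"] show ?case by fastforce
next
  case (4 p X)
  then obtain t where t: "\<sigma> X = Some t" by auto
  then have sort: "has_sort S t (var_sort S X)" and atoms: "nt_atoms t \<subseteq> set as"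
    using \<sigma> \<sigma>_atoms by (auto simp: nominal_subst_def subst_atoms_def ran_def)
  let ?f = "atom_ren S (perm_atom p)" and ?xs = "map (atom_var S) as" and ?r = "tr_term S as nabla t"
  have "beta_eta_eq (tr_const_type S) [] (apps (ren (\<lambda>x. x) (lams ?xs ?r)) (map (\<lambda>x. LVar (?f x)) ?xs))
      (ren (\<lambda>x. if x \<in> set ?xs then ?f x else x) ?r) (tr_sort (var_sort S X))"
    using 4(1) by (intro apps_lams_beta has_type_tr_term[OF sort] snd_atom_ren atom_sort_perm_atom) auto
  \<comment> \<open>The atoms free in \<open>?r\<close> are all listed, and unknowns are fixed by
    \<open>?f\<close>, so the restriction to \<open>?xs\<close> changes nothing.\<close>
  moreover have "ren (\<lambda>x. if x \<in> set ?xs then ?f x else x) ?r = ren ?f ?r"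
    using fv_tr_term[OF atoms, of S nabla] by (intro ren_cong) auto
  moreover have "tr_subst S as nabla \<sigma> (unk_var S as X) = Some (lams ?xs ?r)"
    using t by (simp add: tr_subst_def tr_closed_def)
  ultimately show ?case
    using t 4(1) by (simp add: Let_def lsubst_app_apps tr_term_perm_term comp_def)
qed

lemma tr_subst_tr_closed:
  assumes "has_sort S t \<tau>" "nt_vars t \<subseteq> dom \<sigma>"
  shows "beta_eta_eq (tr_const_type S) [] (lsubst_app (tr_subst S as nabla \<sigma>) (tr_closed S as {} t))
    (tr_closed S as nabla (nsubst_app \<sigma> t))
    (arrs (map snd (map (atom_var S) as)) (tr_sort \<tau>))"
proof -
  have "lsubst_app (tr_subst S as nabla \<sigma>) (tr_closed S as {} t)
      = lams (map (atom_var S) as) (lsubst_app (tr_subst S as nabla \<sigma>) (tr_term S as {} t))"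
    unfolding tr_closed_def
    by (rule lsubst_app_lams[OF tr_subst_has_type]) (auto dest: atom_var_notin_tr_subst)
  then show ?thesis
    using beta_eta_eq_lams[OF tr_subst_tr_term[OF assms]] by (simp only: tr_closed_def)
qed

lemma nom_eq_iff_beta_eta_eq:
  assumes t: "has_sort S t \<tau>" "nt_vars t \<subseteq> dom \<sigma>" "nt_atoms t \<subseteq> set as"
    and u: "has_sort S u \<tau>" "nt_vars u \<subseteq> dom \<sigma>" "nt_atoms u \<subseteq> set as"
  shows "nom_eq nabla (nsubst_app \<sigma> t) (nsubst_app \<sigma> u) \<longleftrightarrow>
    (\<exists>T. beta_eta_eq (tr_const_type S) [] (lsubst_app (tr_subst S as nabla \<sigma>) (tr_closed S as {} t))
      (lsubst_app (tr_subst S as nabla \<sigma>) (tr_closed S as {} u)) T)"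
    (is "?L \<longleftrightarrow> (\<exists>T. ?E T)")
proof
  let ?t = "nsubst_app \<sigma> t" and ?u = "nsubst_app \<sigma> u"
  note sorts = has_sort_nsubst_app[OF t(1) \<sigma>] has_sort_nsubst_app[OF u(1) \<sigma>]
  note eqs = tr_subst_tr_closed[OF t(1,2)] tr_subst_tr_closed[OF u(1,2)]
  {
    assume ?L
    then have "tr_closed S as nabla ?t = tr_closed S as nabla ?u"
      using nom_eq_tr_term[OF _ sorts] by (simp add: tr_closed_def)
    with beta_eta_eq.trans[OF eqs(1)] beta_eta_eq.sym[OF eqs(2)] show "\<exists>T. ?E T" by auto
  next
    assume "\<exists>T. ?E T"
    then have "joinable (tr_closed S as nabla ?t) (tr_closed S as nabla ?u)"
      using eqs[THEN beta_eta_eq_joinable] joinable_trans joinable_sym beta_eta_eq_joinable by meson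
    \<comment> \<open>Closing over the atoms keeps a term full because their arity is 0.\<close>
    moreover have "full (\<lambda>x. case fst x of Inl a \<Rightarrow> 0 | Inr X \<Rightarrow> length (filter (\<lambda>a. (a, X) \<notin> nabla) as))
      (\<lambda>f. length (fst (fun_arity S f))) 0 (tr_closed S as nabla v)" if "has_sort S v \<tau>" for v
      using full_tr_term[OF that] unfolding tr_closed_def
      by (intro full_lams) (auto simp: atom_var_def)
    ultimately have "erase (tr_closed S as nabla ?t) = erase (tr_closed S as nabla ?u)"
      using sorts by (blast intro: full_joinable_erase)
    then have "erase (tr_term S as nabla ?t) = erase (tr_term S as nabla ?u)"
      unfolding tr_closed_def by (rule erase_lams_inject)
    then show ?L
      using sorts t(3) u(3) \<sigma>_atoms nt_atoms_nsubst_app[of \<sigma> t] nt_atoms_nsubst_app[of \<sigma> u]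
      by (intro erase_tr_term_nom_eq) auto
  }
qed

end

theorem theorem5p13:
  fixes S :: "('a, 'x, 'f, 'n, 'd) nsignature"
    and as :: "'a list"
    and nabla :: "('a \<times> 'x) set"
    and P :: "('a, 'x, 'f) nproblem"
    and \<sigma> :: "('a, 'x, 'f) nsubst"
  assumes "finite nabla"
    and "nominal_problem S P"
    and "nominal_subst S \<sigma>"
    and "distinct as"
    and "problem_atoms P \<union> subst_atoms \<sigma> \<union> fst ` nabla \<subseteq> set as"
    and "problem_vars P \<subseteq> dom \<sigma>"
  shows "nominal_solves nabla \<sigma> P \<longleftrightarrow>
    lambda_solves (tr_const_type S) (tr_subst S as nabla \<sigma>) (tr_problem S as P)"
proof -
  have "nom_eq nabla (nsubst_app \<sigma> t) (nsubst_app \<sigma> u) \<longleftrightarrow>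
    (\<exists>T. beta_eta_eq (tr_const_type S) [] (lsubst_app (tr_subst S as nabla \<sigma>) (tr_closed S as {} t))
      (lsubst_app (tr_subst S as nabla \<sigma>) (tr_closed S as {} u)) T)" if tu: "(t, u) \<in> P" for t u
  proof -
    obtain \<tau> where "has_sort S t \<tau>" "has_sort S u \<tau>"
      using assms(2) tu by (auto simp: nominal_problem_def)
    moreover have "nt_atoms t \<subseteq> problem_atoms P" "nt_atoms u \<subseteq> problem_atoms P"
      "nt_vars t \<subseteq> problem_vars P" "nt_vars u \<subseteq> problem_vars P"
      using tu by (auto simp: problem_atoms_def problem_vars_def)
    ultimately show ?thesis
      using assms(3,5,6) by (intro nom_eq_iff_beta_eta_eq) auto
  qed
  then show ?thesis
    by (fastforce simp: nominal_solves_def lambda_solves_def tr_problem_def)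
qed

end
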